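(* Let $a,b$ be real numbers, and let $L^*$ be the $N\times N$ tridiagonal matrix with $L^*_{i,j}=a$ if $i=j$, $L^*_{i,j}=b$ if $|i-j|=1$, and $L^*_{i,j}=0$ otherwise. Assume that $a>0$ and $a^2>4b^2$. Then $L^*\in\mathcal S_{[N]}^{++}$, and there exist two positive numbers $c_1$ and $c_2$ that depend only on $a$ and $b$ such that, with $\Phi=\Phi_{L^*}$ the expected log-likelihood, $$0<\inf_{H\in\mathcal S_{[N]}:\ \|H\|_F=1}-\mathrm d^2\Phi(L^* )(H,H)\le c_1e^{-c_2N}.$$
   Context: Let $N$ be a positive integer and $[N]=\{1,\dots,N\}$. $\mathcal S_{[N]}$ is the space of real symmetric $N\times N$ matrices, $\mathcal S_{[N]}^{++}$ is the (open) subset of positive definite ones, and $\|\cdot\|_F$ is the Frobenius norm. For an $N\times N$ matrix $A$ and $J\subseteq[N]$, $A_J$ is the restriction of $A$ to $J\times J$; convention: $\det A_\emptyset=1$. For $L\in\mathcal S_{[N]}^{++}$, put $p_J(L)=\det(L_J)/\det(I+L)$, $J\subseteq[N]$ (the probability mass function of the determinantal point process with kernel $L$). For fixed $L^*\in\mathcal S_{[N]}^{++}$, the expected log-likelihood is $$\Phi_{L^*}(L)=\sum_{J\subseteq[N]}p_J(L^* )\log\det(L_J)-\log\det(I+L),\qquad L\in\mathcal S_{[N]}^{++}.$$ $\mathrm d^2\Phi(L)$ denotes the second derivative (Hessian) of $\Phi$ at $L$, a bilinear form on $\mathcal S_{[N]}$.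
   Formalization: The strict inequality 0 < inf is claimed only when b ≠ 0 or N = 1; for b = 0 and N ≥ 2 it is false, since H = (E_12+E_21)/√2 gives d²Φ(L* )(H,H) = 0. All other claims are kept for b = 0. *)

theory Defs
  imports
    Complex_Main
    "Jordan_Normal_Form.Determinant"
    "Jordan_Normal_Form.DL_Submatrix"
begin

text \<open>
  Matrices have the type \<^typ>\<open>real mat\<close>, whose dimension is a value, so that constants can be
  chosen uniformly in the dimension \<open>N\<close>. The index set is \<open>{..<N}\<close> instead of \<open>{1..N}\<close>.
\<close>

definition sym_mats :: "nat \<Rightarrow> real mat set" where
  "sym_mats N = {A \<in> carrier_mat N N. transpose_mat A = A}"

definition spd_mats :: "nat \<Rightarrow> real mat set" where
  "spd_mats N =
     {A \<in> sym_mats N. \<forall>x \<in> carrier_vec N. x \<noteq> 0\<^sub>v N \<longrightarrow> x \<bullet> (A *\<^sub>v x) > 0}"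

definition frobenius_norm :: "real mat \<Rightarrow> real" where
  "frobenius_norm A = sqrt (\<Sum>i<dim_row A. \<Sum>j<dim_col A. (A $$ (i, j))\<^sup>2)"

text \<open>
  \<^typ>\<open>real mat\<close> is not a normed space (it mixes all dimensions), so the Frechet derivative
  of the library does not apply. The following definitions spell it out on the finite-dimensional
  normed space \<open>(sym_mats N, frobenius_norm)\<close>; boundedness of linear maps is automatic there.
\<close>

definition linear_on_sym :: "nat \<Rightarrow> (real mat \<Rightarrow> real) \<Rightarrow> bool" where
  "linear_on_sym N D \<longleftrightarrow>
     (\<forall>H \<in> sym_mats N. \<forall>K \<in> sym_mats N. D (H + K) = D H + D K) \<and>
     (\<forall>c. \<forall>H \<in> sym_mats N. D (c \<cdot>\<^sub>m H) = c * D H)"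

definition bilinear_on_sym :: "nat \<Rightarrow> (real mat \<Rightarrow> real mat \<Rightarrow> real) \<Rightarrow> bool" where
  "bilinear_on_sym N B \<longleftrightarrow>
     (\<forall>K \<in> sym_mats N. linear_on_sym N (\<lambda>H. B K H)) \<and>
     (\<forall>H \<in> sym_mats N. linear_on_sym N (\<lambda>K. B K H))"

definition has_derivative_sym ::
  "nat \<Rightarrow> (real mat \<Rightarrow> real) \<Rightarrow> real mat \<Rightarrow> (real mat \<Rightarrow> real) \<Rightarrow> bool" where
  "has_derivative_sym N f L D \<longleftrightarrow>
     linear_on_sym N D \<and>
     (\<forall>e>0. \<exists>d>0. \<forall>H \<in> sym_mats N. frobenius_norm H < d \<longrightarrow>
        \<bar>f (L + H) - f L - D H\<bar> \<le> e * frobenius_norm H)"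

text \<open>
  \<open>B\<close> is the Frechet derivative at \<open>L\<close> of the map \<open>M \<mapsto> D M\<close> into the dual space (with its
  operator norm), where \<open>D M\<close> is the derivative of \<open>f\<close> at each \<open>M\<close> near \<open>L\<close>. Only the values of
  \<open>f\<close> near \<open>L\<close> matter, so it is harmless that \<open>f\<close> is total when \<open>L\<close> is interior to the intended
  domain.
\<close>

definition has_second_derivative_sym ::
  "nat \<Rightarrow> (real mat \<Rightarrow> real) \<Rightarrow> real mat \<Rightarrow> (real mat \<Rightarrow> real mat \<Rightarrow> real) \<Rightarrow> bool" where
  "has_second_derivative_sym N f L B \<longleftrightarrow>
     bilinear_on_sym N B \<and>
     (\<exists>D. \<exists>r>0.
        (\<forall>M \<in> sym_mats N. frobenius_norm (M - L) < r \<longrightarrow> has_derivative_sym N f M (D M)) \<and>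
        (\<forall>e>0. \<exists>d>0. \<forall>K \<in> sym_mats N. frobenius_norm K < d \<longrightarrow>
           (\<forall>H \<in> sym_mats N.
              \<bar>D (L + K) H - D L H - B K H\<bar> \<le> e * frobenius_norm K * frobenius_norm H)))"

definition dpp_pmf :: "nat \<Rightarrow> real mat \<Rightarrow> nat set \<Rightarrow> real" where
  "dpp_pmf N L J = det (submatrix L J J) / det (1\<^sub>m N + L)"

definition expected_log_likelihood :: "nat \<Rightarrow> real mat \<Rightarrow> real mat \<Rightarrow> real" where
  "expected_log_likelihood N Lstar L =
     (\<Sum>J \<in> Pow {..<N}. dpp_pmf N Lstar J * ln (det (submatrix L J J))) - ln (det (1\<^sub>m N + L))"

definition tridiag_mat :: "nat \<Rightarrow> real \<Rightarrow> real \<Rightarrow> real mat" where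
  "tridiag_mat N a b =
     mat N N (\<lambda>(i, j). if i = j then a else if \<bar>int i - int j\<bar> = 1 then b else 0)"

text \<open>Second derivatives are unique as bilinear forms on \<^term>\<open>sym_mats N\<close>.\<close>

lemma sym_mats_closed:
  assumes "H \<in> sym_mats N"
  shows "c \<cdot>\<^sub>m H \<in> sym_mats N"
    and "K \<in> sym_mats N \<Longrightarrow> K + H \<in> sym_mats N"
  using assms unfolding sym_mats_def
  by (auto simp: transpose_add intro!: eq_matI) (metis carrier_matD index_transpose_mat(1))

lemma frobenius_norm_nonneg: "frobenius_norm A \<ge> 0"
  unfolding frobenius_norm_def by (intro real_sqrt_ge_zero sum_nonneg) auto

lemma frobenius_norm_smult: "frobenius_norm (c \<cdot>\<^sub>m A) = \<bar>c\<bar> * frobenius_norm A"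
proof -
  have "(\<Sum>i<dim_row A. \<Sum>j<dim_col A. ((c \<cdot>\<^sub>m A) $$ (i, j))\<^sup>2)
      = c\<^sup>2 * (\<Sum>i<dim_row A. \<Sum>j<dim_col A. (A $$ (i, j))\<^sup>2)"
    by (simp add: sum_distrib_left power_mult_distrib)
  then show ?thesis
    unfolding frobenius_norm_def by (simp add: real_sqrt_mult)
qed

lemma abs_diff_le_of_close:
  fixes x p q c :: real
  assumes "\<bar>x - p\<bar> * 2 \<le> c" and "\<bar>x - q\<bar> * 2 \<le> c"
  shows "\<bar>p - q\<bar> \<le> c"
  using assms by (auto simp: abs_if split: if_splits)

lemma linear_small_imp_zero:
  assumes hom: "\<And>t. g (t \<cdot>\<^sub>m H) = t * g H"
    and H: "H \<in> sym_mats N" and C: "C \<ge> 0"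
    and small: "\<And>e. e > 0 \<Longrightarrow> \<exists>d>0. \<forall>K \<in> sym_mats N. frobenius_norm K < d \<longrightarrow>
                   \<bar>g K\<bar> \<le> e * frobenius_norm K * C"
  shows "g H = (0::real)"
proof (rule ccontr)
  assume nz: "g H \<noteq> 0"
  define n where "n = frobenius_norm H"
  have n: "n \<ge> 0" by (simp add: n_def frobenius_norm_nonneg)
  have nC: "n * C \<ge> 0" using n C by simp
  define e where "e = \<bar>g H\<bar> / (2 * (n * C + 1))"
  have e: "e > 0" using nz nC by (simp add: e_def)
  obtain d where d: "d > 0"
    "\<And>K. K \<in> sym_mats N \<Longrightarrow> frobenius_norm K < d \<Longrightarrow> \<bar>g K\<bar> \<le> e * frobenius_norm K * C"
    using small[OF e] by blast
  define t where "t = d / (2 * (n + 1))"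
  have t: "t > 0" using d n by (simp add: t_def)
  have "t * n < d" using d n by (simp add: t_def field_simps add_nonneg_pos)
  then have "\<bar>g (t \<cdot>\<^sub>m H)\<bar> \<le> e * frobenius_norm (t \<cdot>\<^sub>m H) * C"
    using t sym_mats_closed(1)[OF H] by (intro d(2)) (auto simp: frobenius_norm_smult n_def)
  then have "t * \<bar>g H\<bar> \<le> t * (e * (n * C))"
    using t by (simp add: hom frobenius_norm_smult n_def abs_mult mult_ac)
  then have "\<bar>g H\<bar> \<le> e * (n * C)" using t by simp
  also have "\<dots> \<le> e * (n * C + 1)" using e by simp
  also have "\<dots> = \<bar>g H\<bar> / 2" using nC by (simp add: e_def field_simps)
  finally show False using nz by simp
qed

lemma has_derivative_sym_unique:
  assumes "has_derivative_sym N f L D" "has_derivative_sym N f L D'" "H \<in> sym_mats N"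
  shows "D H = D' H"
proof -
  have "D H - D' H = 0"
  proof (rule linear_small_imp_zero[where g = "\<lambda>H. D H - D' H" and N = N and C = 1])
    show "D (t \<cdot>\<^sub>m H) - D' (t \<cdot>\<^sub>m H) = t * (D H - D' H)" for t
      using assms by (simp add: has_derivative_sym_def linear_on_sym_def right_diff_distrib)
    fix e :: real assume "e > 0"
    then have e2: "e / 2 > 0" by simp
    obtain d where d: "d > 0" "\<And>H. H \<in> sym_mats N \<Longrightarrow> frobenius_norm H < d \<Longrightarrow>
        \<bar>f (L + H) - f L - D H\<bar> \<le> e / 2 * frobenius_norm H"
      using assms(1) e2 unfolding has_derivative_sym_def by blast
    obtain d' where d': "d' > 0" "\<And>H. H \<in> sym_mats N \<Longrightarrow> frobenius_norm H < d' \<Longrightarrow>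
        \<bar>f (L + H) - f L - D' H\<bar> \<le> e / 2 * frobenius_norm H"
      using assms(2) e2 unfolding has_derivative_sym_def by blast
    show "\<exists>d>0. \<forall>K \<in> sym_mats N. frobenius_norm K < d \<longrightarrow>
        \<bar>D K - D' K\<bar> \<le> e * frobenius_norm K * 1"
    proof (intro exI[of _ "min d d'"] conjI ballI impI)
      fix K assume K: "K \<in> sym_mats N" "frobenius_norm K < min d d'"
      show "\<bar>D K - D' K\<bar> \<le> e * frobenius_norm K * 1"
        using d(2)[of K] d'(2)[of K] K
        by (intro abs_diff_le_of_close[where x = "f (L + K) - f L"]) simp_all
    qed (use d d' in auto)
  qed (use assms in auto)
  then show ?thesis by simp
qed

lemma has_second_derivative_sym_unique:
  assumes B: "has_second_derivative_sym N f L B" and B': "has_second_derivative_sym N f L B'"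
    and L: "L \<in> sym_mats N" and K: "K \<in> sym_mats N" and H: "H \<in> sym_mats N"
  shows "B K H = B' K H"
proof -
  obtain D r where D: "r > 0"
    "\<And>M. M \<in> sym_mats N \<Longrightarrow> frobenius_norm (M - L) < r \<Longrightarrow> has_derivative_sym N f M (D M)"
    "\<And>e. e > 0 \<Longrightarrow> \<exists>d>0. \<forall>K \<in> sym_mats N. frobenius_norm K < d \<longrightarrow> (\<forall>H \<in> sym_mats N.
       \<bar>D (L + K) H - D L H - B K H\<bar> \<le> e * frobenius_norm K * frobenius_norm H)"
    using B unfolding has_second_derivative_sym_def by blast
  obtain D' r' where D': "r' > 0"
    "\<And>M. M \<in> sym_mats N \<Longrightarrow> frobenius_norm (M - L) < r' \<Longrightarrow> has_derivative_sym N f M (D' M)"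
    "\<And>e. e > 0 \<Longrightarrow> \<exists>d>0. \<forall>K \<in> sym_mats N. frobenius_norm K < d \<longrightarrow> (\<forall>H \<in> sym_mats N.
       \<bar>D' (L + K) H - D' L H - B' K H\<bar> \<le> e * frobenius_norm K * frobenius_norm H)"
    using B' unfolding has_second_derivative_sym_def by blast
  have eq: "D (L + M) H = D' (L + M) H"
    if "M \<in> sym_mats N" "frobenius_norm M < r" "frobenius_norm M < r'" for M
  proof -
    have "L + M - L = M" using that(1) L by (auto simp: sym_mats_def intro!: eq_matI)
    then show ?thesis
      using that has_derivative_sym_unique[OF D(2) D'(2) H] sym_mats_closed(2)[OF that(1) L]
      by simp
  qed
  have "0 \<cdot>\<^sub>m L \<in> sym_mats N" by (rule sym_mats_closed(1)[OF L])
  moreover have "L + 0 \<cdot>\<^sub>m L = L" using L by (auto simp: sym_mats_def intro!: eq_matI)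
  ultimately have eq0: "D L H = D' L H"
    using eq[of "0 \<cdot>\<^sub>m L"] D(1) D'(1) by (simp add: frobenius_norm_smult)
  have "B K H - B' K H = 0"
  proof (rule linear_small_imp_zero[where g = "\<lambda>K. B K H - B' K H" and N = N
        and C = "frobenius_norm H"])
    show "B (t \<cdot>\<^sub>m K) H - B' (t \<cdot>\<^sub>m K) H = t * (B K H - B' K H)" for t
      using B B' H K
      by (simp add: has_second_derivative_sym_def bilinear_on_sym_def linear_on_sym_def
          right_diff_distrib)
    fix e :: real assume "e > 0"
    then have e2: "e / 2 > 0" by simp
    obtain d where d: "d > 0" "\<And>K. K \<in> sym_mats N \<Longrightarrow> frobenius_norm K < d \<Longrightarrow>
        \<bar>D (L + K) H - D L H - B K H\<bar> \<le> e / 2 * frobenius_norm K * frobenius_norm H"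
      using D(3)[OF e2] H by blast
    obtain d' where d': "d' > 0" "\<And>K. K \<in> sym_mats N \<Longrightarrow> frobenius_norm K < d' \<Longrightarrow>
        \<bar>D' (L + K) H - D' L H - B' K H\<bar> \<le> e / 2 * frobenius_norm K * frobenius_norm H"
      using D'(3)[OF e2] H by blast
    show "\<exists>d>0. \<forall>K \<in> sym_mats N. frobenius_norm K < d \<longrightarrow>
        \<bar>B K H - B' K H\<bar> \<le> e * frobenius_norm K * frobenius_norm H"
    proof (intro exI[of _ "min (min d d') (min r r')"] conjI ballI impI)
      fix K assume K: "K \<in> sym_mats N" "frobenius_norm K < min (min d d') (min r r')"
      show "\<bar>B K H - B' K H\<bar> \<le> e * frobenius_norm K * frobenius_norm H"
        using d(2)[of K] d'(2)[of K] K eq[of K] eq0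
        by (intro abs_diff_le_of_close[where x = "D (L + K) H - D L H"]) simp_all
    qed (use d d' D(1) D'(1) in auto)
  qed (use K frobenius_norm_nonneg in auto)
  then show ?thesis by simp
qed

end

theory Submission
  imports Defs "HOL-Analysis.Bounded_Continuous_Function"
    "HOL-Analysis.Derivative"
begin

text \<open>
  Write \<open>Z = det (I + L)\<close> as the sum of all principal minors of \<open>L\<close>. At \<open>L = L*\<close> the weights
  \<open>p J = det L*\<^sub>J / Z\<close> make the second-order terms \<open>D\<^sup>2 det\<close> of \<open>\<Sum>J. p J * ln (det L\<^sub>J)\<close> and of
  \<open>ln Z\<close> cancel, so the Hessian at \<open>L*\<close> is minus the covariance of the score
  \<open>J \<mapsto> D(det)(L*\<^sub>J)(H\<^sub>J) / det L*\<^sub>J\<close> under the determinantal process.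

  If this variance is small, then so is the score at every \<open>J\<close>, because the score vanishes at the
  empty set. Taking \<open>J = {i..j}\<close> recovers \<open>H\<^sub>i\<^sub>j\<close> by induction on the distance to the diagonal,
  since the corner cofactor of the tridiagonal block is \<open>b ^ (j - i)\<close> up to sign. For the upper bound
  take \<open>H\<close> supported on the two corners \<open>(0, N - 1)\<close>, \<open>(N - 1, 0)\<close>: only \<open>J = {..<N}\<close> has a nonzero
  score, which is of order \<open>b ^ (N - 1) / det L*\<close>, and \<open>\<bar>b\<bar> < a/2\<close>,
  \<open>det L* \<ge> (a/2)^N\<close>, \<open>det (I + L*) \<ge> ((a+1)/2)^N\<close>.
\<close>

subsection \<open>Principal minors\<close>

definition pminor :: "nat set \<Rightarrow> (nat \<Rightarrow> nat \<Rightarrow> real) \<Rightarrow> real" where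
  "pminor J A = (\<Sum>p | p permutes J. of_int (sign p) * (\<Prod>i\<in>J. A i (p i)))"

text \<open>For \<open>i\<close> and \<open>j\<close> in \<open>J\<close> this is the signed
  cofactor: the coefficient of \<open>A i j\<close> in the Leibniz expansion over
  \<open>J\<close>.\<close>

definition pcof :: "nat set \<Rightarrow> (nat \<Rightarrow> nat \<Rightarrow> real) \<Rightarrow> nat \<Rightarrow> nat \<Rightarrow> real" where
  "pcof J A i j = (\<Sum>p | p permutes J \<and> p i = j. of_int (sign p) * (\<Prod>k\<in>J - {i}. A k (p k)))"

text \<open>The product rule applied to every Leibniz term: the directional derivative of the minor
  at \<open>A\<close> along \<open>H\<close>, as \<open>has_derivative_pminor\<close>
  confirms.\<close>

definition dminor :: "nat set \<Rightarrow> (nat \<Rightarrow> nat \<Rightarrow> real) \<Rightarrow> (nat \<Rightarrow> nat \<Rightarrow> real) \<Rightarrow> real" where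
  "dminor J A H =
     (\<Sum>p | p permutes J. of_int (sign p) * (\<Sum>i\<in>J. H i (p i) * (\<Prod>k\<in>J - {i}. A k (p k))))"

lemma pminor_empty [simp]: "pminor {} A = 1"
  by (simp add: pminor_def)

lemma pminor_cong:
  assumes "\<And>i j. i \<in> J \<Longrightarrow> j \<in> J \<Longrightarrow> A i j = B i j"
  shows "pminor J A = pminor J B"
  unfolding pminor_def using assms
  by (intro sum.cong refl arg_cong2[where f = "(*)"] prod.cong) (auto simp: permutes_in_image)

text \<open>For a fixed row \<open>i\<close>, the permutations are grouped by the image
  \<open>j\<close> of \<open>i\<close>; each group adds up to \<open>H i j\<close> times a
  cofactor.\<close>

lemma dminor_eq_sum_pcof:
  assumes "finite J"
  shows "dminor J A H = (\<Sum>i\<in>J. \<Sum>j\<in>J. H i j * pcof J A i j)"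
proof -
  have *: "(\<Sum>p | p permutes J. of_int (sign p) * (H i (p i) * (\<Prod>k\<in>J - {i}. A k (p k))))
      = (\<Sum>j\<in>J. H i j * pcof J A i j)" if "i \<in> J" for i
  proof -
    have "(\<Sum>p | p permutes J. of_int (sign p) * (H i (p i) * (\<Prod>k\<in>J - {i}. A k (p k))))
       = (\<Sum>j\<in>J. \<Sum>p | p \<in> {p. p permutes J} \<and> p i = j.
            of_int (sign p) * (H i (p i) * (\<Prod>k\<in>J - {i}. A k (p k))))"
      using assms that by (intro sum.group[symmetric]) (auto simp: finite_permutations permutes_in_image)
    also have "\<dots> = (\<Sum>j\<in>J. H i j * pcof J A i j)"
      unfolding pcof_def sum_distrib_left by (intro sum.cong) auto
    finally show ?thesis .
  qed
  have "dminor J A H =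
      (\<Sum>i\<in>J. \<Sum>p | p permutes J. of_int (sign p) * (H i (p i) * (\<Prod>k\<in>J - {i}. A k (p k))))"
    unfolding dminor_def sum_distrib_left by (rule sum.swap)
  then show ?thesis using * by simp
qed

text \<open>Transporting permutations along the bijection \<open>f\<close> preserves signs and
  matches the Leibniz products term by term. With \<open>pick J\<close> as \<open>f\<close>, this
  identifies the determinant of a submatrix with a minor on the original indices.\<close>

lemma pminor_reindex:
  assumes f: "bij_betw f S T" and S: "finite S"
  shows "pminor T A = pminor S (\<lambda>i j. A (f i) (f j))"
proof -
  let ?g = "inv_into S f"
  have g: "bij_betw ?g T S" using f by (rule bij_betw_inv_into)
  have inj: "inj_on f S" using f by (rule bij_betw_imp_inj_on)
  have "pminor S (\<lambda>i j. A (f i) (f j)) = pminor T A"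
    unfolding pminor_def
  proof (rule sum.reindex_bij_witness[where j = "map_permutation S f" and i = "map_permutation T ?g"])
    fix p assume "p \<in> {p. p permutes S}"
    then have p: "p permutes S" by simp
    show "map_permutation T ?g (map_permutation S f p) = p"
      by (rule map_permutation_compose_inv[OF f p]) (simp add: inj)
    show "map_permutation S f p \<in> {p. p permutes T}"
      using map_permutation_permutes[OF f p] by simp
    have "(\<Prod>i\<in>T. A i (map_permutation S f p i)) = (\<Prod>i\<in>S. A (f i) (map_permutation S f p (f i)))"
      using f by (rule prod.reindex_bij_betw[symmetric])
    also have "\<dots> = (\<Prod>i\<in>S. A (f i) (f (p i)))"
      by (intro prod.cong) (simp_all add: map_permutation_apply inj)
    finally show "of_int (sign (map_permutation S f p)) * (\<Prod>i\<in>T. A i (map_permutation S f p i))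
        = of_int (sign p) * (\<Prod>i\<in>S. A (f i) (f (p i)))"
      by (simp add: sign_map_permutation[OF inj p S])
  next
    fix p assume "p \<in> {p. p permutes T}"
    then have p: "p permutes T" by simp
    show "map_permutation S f (map_permutation T ?g p) = p"
      by (rule map_permutation_compose_inv[OF g p]) (use f in \<open>simp add: bij_betw_inv_into_right\<close>)
    show "map_permutation T ?g p \<in> {p. p permutes S}"
      using map_permutation_permutes[OF g p] by simp
  qed
  then show ?thesis by simp
qed

lemma det_eq_pminor:
  assumes "M \<in> carrier_mat n n"
  shows "det M = pminor {..<n} (\<lambda>i j. M $$ (i, j))"
  using assms by (simp add: det_def pminor_def atLeast0LessThan)

lemma bij_betw_pick:
  assumes "finite J"
  shows "bij_betw (pick J) {..<card J} J"
proof -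
  have "inj_on (pick J) {..<card J}"
    by (rule linorder_inj_onI) (use pick_mono_le in \<open>fastforce+\<close>)
  moreover have "pick J ` {..<card J} \<subseteq> J"
    using pick_in_set_le by auto
  ultimately show ?thesis
    using assms by (simp add: bij_betw_def card_image card_subset_eq)
qed

lemma det_submatrix_eq_pminor:
  assumes L: "L \<in> carrier_mat N N" and J: "J \<subseteq> {..<N}"
  shows "det (submatrix L J J) = pminor J (\<lambda>i j. L $$ (i, j))"
proof -
  have J': "{i. i < N \<and> i \<in> J} = J" "finite J" using J finite_subset by auto
  have "submatrix L J J \<in> carrier_mat (card J) (card J)"
    using L J' by (auto simp: submatrix_def)
  then have "det (submatrix L J J) = pminor {..<card J} (\<lambda>i j. submatrix L J J $$ (i, j))"
    by (rule det_eq_pminor)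
  also have "\<dots> = pminor {..<card J} (\<lambda>i j. L $$ (pick J i, pick J j))"
    using L J' by (intro pminor_cong) (auto simp: submatrix_def)
  also have "\<dots> = pminor J (\<lambda>i j. L $$ (i, j))"
    by (rule pminor_reindex[symmetric]) (use bij_betw_pick J' in auto)
  finally show ?thesis .
qed

text \<open>Expand every product over the set \<open>J\<close> of rows that take their factor from
  \<open>A\<close>. The remaining rows take theirs from the identity, so only permutations fixing
  everything outside \<open>J\<close> survive.\<close>

lemma pminor_identity_add:
  assumes "finite S"
  shows "pminor S (\<lambda>i j. (if i = j then 1 else 0) + A i j) = (\<Sum>J\<in>Pow S. pminor J A)"
proof -
  let ?d = "\<lambda>(i::nat) j::nat. if i = j then 1 else (0::real)"
  have *: "(\<Sum>p | p permutes S. of_int (sign p) * ((\<Prod>i\<in>J. A i (p i)) * (\<Prod>i\<in>S - J. ?d i (p i)))) = pminor J A"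
    if J: "J \<in> Pow S" for J
  proof -
    have "(\<Sum>p | p permutes S. of_int (sign p) * ((\<Prod>i\<in>J. A i (p i)) * (\<Prod>i\<in>S - J. ?d i (p i))))
       = (\<Sum>p | p permutes J. of_int (sign p) * ((\<Prod>i\<in>J. A i (p i)) * (\<Prod>i\<in>S - J. ?d i (p i))))"
    proof (rule sum.mono_neutral_right)
      show "finite {p. p permutes S}" using assms by (rule finite_permutations)
      show "{p. p permutes J} \<subseteq> {p. p permutes S}" using J permutes_subset by auto
      show "\<forall>p\<in>{p. p permutes S} - {p. p permutes J}.
          of_int (sign p) * ((\<Prod>i\<in>J. A i (p i)) * (\<Prod>i\<in>S - J. ?d i (p i))) = 0"
      proof
        fix p assume "p \<in> {p. p permutes S} - {p. p permutes J}"
        then have "p permutes S" "\<not> p permutes J" by auto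
        then obtain i where "i \<in> S - J" "i \<noteq> p i"
          using permutes_superset by metis
        then have "(\<Prod>i\<in>S - J. ?d i (p i)) = 0"
          using assms by (intro prod_zero) auto
        then show "of_int (sign p) * ((\<Prod>i\<in>J. A i (p i)) * (\<Prod>i\<in>S - J. ?d i (p i))) = 0" by simp
      qed
    qed
    also have "\<dots> = pminor J A"
      unfolding pminor_def using J
      by (intro sum.cong refl) (auto simp: permutes_def intro!: prod.neutral)
    finally show ?thesis .
  qed
  have "pminor S (\<lambda>i j. ?d i j + A i j) = (\<Sum>p | p permutes S. \<Sum>J\<in>Pow S.
      of_int (sign p) * ((\<Prod>i\<in>J. A i (p i)) * (\<Prod>i\<in>S - J. ?d i (p i))))"
    unfolding pminor_def using assms
    by (subst add.commute) (simp add: prod_add sum_distrib_left)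
  also have "\<dots> = (\<Sum>J\<in>Pow S. pminor J A)"
    by (subst sum.swap) (simp add: *)
  finally show ?thesis .
qed

lemma det_identity_add:
  assumes L: "L \<in> carrier_mat N N"
  shows "det (1\<^sub>m N + L) = (\<Sum>J\<in>Pow {..<N}. pminor J (\<lambda>i j. L $$ (i, j)))"
proof -
  have "det (1\<^sub>m N + L) = pminor {..<N} (\<lambda>i j. (1\<^sub>m N + L) $$ (i, j))"
    using L by (intro det_eq_pminor) auto
  also have "\<dots> = pminor {..<N} (\<lambda>i j. (if i = j then 1 else 0) + L $$ (i, j))"
    using L by (intro pminor_cong) auto
  finally show ?thesis by (simp add: pminor_identity_add)
qed

text \<open>Expansion along row \<open>m\<close>: each permutation of \<open>insert m J\<close> is a
  transposition of \<open>m\<close> and \<open>c\<close> after a permutation \<open>q\<close> of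
  \<open>J\<close>, and the sign flips exactly when \<open>c\<close> differs from
  \<open>m\<close>.\<close>

lemma pminor_insert:
  assumes J: "finite J" "m \<notin> J"
  shows "pminor (insert m J) A = A m m * pminor J A -
     (\<Sum>c\<in>J. A m c * (\<Sum>q | q permutes J. of_int (sign q) * (\<Prod>i\<in>J. A i (Transposition.transpose m c (q i)))))"
proof -
  let ?t = "\<lambda>c q. of_int (sign (Transposition.transpose m c \<circ> q)) * (\<Prod>i\<in>insert m J. A i ((Transposition.transpose m c \<circ> q) i))"
  have prod: "(\<Prod>i\<in>insert m J. A i ((Transposition.transpose m c \<circ> q) i)) =
      A m c * (\<Prod>i\<in>J. A i (Transposition.transpose m c (q i)))" if "q permutes J" for c q
    using J that by (simp add: permutes_not_in)
  have sign: "sign (Transposition.transpose m c \<circ> q) = (if c = m then sign q else - sign q)" if "q permutes J" for c q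
    using that J permutation_permutes
    by (subst sign_compose) (auto simp: sign_swap_id permutation_swap_id)
  have "pminor (insert m J) A = (\<Sum>c\<in>insert m J. \<Sum>q | q permutes J. ?t c q)"
    unfolding pminor_def using J by (rule sum_over_permutations_insert)
  also have "\<dots> = (\<Sum>q | q permutes J. ?t m q) + (\<Sum>c\<in>J. \<Sum>q | q permutes J. ?t c q)"
    using J by simp
  also have "(\<Sum>q | q permutes J. ?t m q) = A m m * pminor J A"
    unfolding pminor_def sum_distrib_left
    by (intro sum.cong refl) (simp only: prod sign mem_Collect_eq, simp)
  also have "(\<Sum>c\<in>J. \<Sum>q | q permutes J. ?t c q) = (\<Sum>c\<in>J. - (A m c *
      (\<Sum>q | q permutes J. of_int (sign q) * (\<Prod>i\<in>J. A i (Transposition.transpose m c (q i))))))"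
    unfolding sum_distrib_left sum_negf[symmetric] using J
    by (intro sum.cong refl) (simp only: prod sign mem_Collect_eq, auto)
  finally show ?thesis by (simp add: sum_negf)
qed

lemma pminor_insert_isolated:
  assumes "finite J" "m \<notin> J" "\<And>c. c \<in> J \<Longrightarrow> A m c = 0"
  shows "pminor (insert m J) A = A m m * pminor J A"
  using assms by (simp add: pminor_insert)

text \<open>Reading nonzero off-diagonal entries as edges, \<open>m\<close> is joined to
  \<open>J\<close> at most through \<open>k\<close>. Hence only \<open>c = k\<close> survives in row
  \<open>m\<close>. The row that \<open>q\<close> sends to \<open>k\<close> then carries an entry of
  column \<open>m\<close>, which vanishes unless that row is \<open>k\<close> itself, so
  \<open>q\<close> fixes \<open>k\<close>.\<close>

lemma pminor_insert_leaf:
  assumes J: "finite J" "m \<notin> J" "k \<in> J"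
    and A: "\<And>c. c \<in> J \<Longrightarrow> c \<noteq> k \<Longrightarrow> A m c = 0" "\<And>c. c \<in> J \<Longrightarrow> c \<noteq> k \<Longrightarrow> A c m = 0"
  shows "pminor (insert m J) A = A m m * pminor J A - A m k * A k m * pminor (J - {k}) A"
proof -
  have fix_k: "{q. q permutes J - {k}} = {q. q permutes J \<and> q k = k}"
    by (auto simp: permutes_def)
  let ?t = "\<lambda>q. of_int (sign q) * (\<Prod>i\<in>J. A i (Transposition.transpose m k (q i)))"
  have "(\<Sum>q | q permutes J. ?t q) = (\<Sum>q | q permutes J \<and> q k = k. ?t q)"
  proof (rule sum.mono_neutral_right)
    show "\<forall>q\<in>{q. q permutes J} - {q. q permutes J \<and> q k = k}. ?t q = 0"
    proof
      fix q assume "q \<in> {q. q permutes J} - {q. q permutes J \<and> q k = k}"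
      then have q: "q permutes J" "q k \<noteq> k" by auto
      have "k \<in> q ` J" using J(3) permutes_image[OF q(1)] by simp
      then obtain i where i: "i \<in> J" "q i = k" by auto
      then have "i \<noteq> k" using q(2) by auto
      then have "A i (Transposition.transpose m k (q i)) = 0" using i A(2)[of i] by simp
      then have "(\<Prod>i\<in>J. A i (Transposition.transpose m k (q i))) = 0"
        using i J(1) by (intro prod_zero bexI[of _ i])
      then show "?t q = 0" by simp
    qed
  qed (use J finite_permutations in auto)
  also have "\<dots> = (\<Sum>q | q permutes J - {k}. A k m * (of_int (sign q) * (\<Prod>i\<in>J - {k}. A i (q i))))"
    unfolding fix_k
  proof (intro sum.cong refl)
    fix q assume "q \<in> {q. q permutes J \<and> q k = k}"
    then have q: "q permutes J" "q k = k" by auto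
    have "(\<Prod>i\<in>J. A i (Transposition.transpose m k (q i))) = A k m * (\<Prod>i\<in>J - {k}. A i (Transposition.transpose m k (q i)))"
      using J q by (subst prod.remove[of J k]) auto
    also have "(\<Prod>i\<in>J - {k}. A i (Transposition.transpose m k (q i))) = (\<Prod>i\<in>J - {k}. A i (q i))"
    proof (intro prod.cong refl)
      fix i assume i: "i \<in> J - {k}"
      then have "q i \<in> J" using permutes_in_image[OF q(1)] by simp
      then have "q i \<noteq> m" using J(2) by auto
      moreover have "q i \<noteq> k" using i q(2) injD[OF permutes_inj[OF q(1)], of i k] by auto
      ultimately show "A i (Transposition.transpose m k (q i)) = A i (q i)"
        by simp
    qed
    finally show "?t q = A k m * (of_int (sign q) * (\<Prod>i\<in>J - {k}. A i (q i)))" by simp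
  qed
  also have "\<dots> = A k m * pminor (J - {k}) A"
    by (simp add: pminor_def sum_distrib_left)
  finally have *: "(\<Sum>q | q permutes J. ?t q) = A k m * pminor (J - {k}) A" .
  have "(\<Sum>c\<in>J. A m c * (\<Sum>q | q permutes J. of_int (sign q) * (\<Prod>i\<in>J. A i (Transposition.transpose m c (q i)))))
      = A m k * (\<Sum>q | q permutes J. ?t q)"
    using J A(1) by (subst sum.remove[of J k]) auto
  then show ?thesis
    using J * by (simp add: pminor_insert)
qed

subsection \<open>Minors and corner cofactors of tridiagonal matrices\<close>

definition tridiag :: "real \<Rightarrow> real \<Rightarrow> nat \<Rightarrow> nat \<Rightarrow> real" where
  "tridiag a b i j = (if i = j then a else if \<bar>int i - int j\<bar> = 1 then b else 0)"

text \<open>Positivity alone does not pass through the three-term recurrence, so the induction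
  carries the growth factor \<open>a / 2\<close> as well. Indices are added in increasing order, so
  the new index \<open>m\<close> can be adjacent only to the current maximum
  \<open>l\<close>.\<close>

lemma pminor_tridiag_insert_ge:
  assumes ab: "a > 0" "a\<^sup>2 > 4 * b\<^sup>2" and J: "finite J" "J \<subseteq> {..<m}"
  shows "pminor J (tridiag a b) > 0 \<and>
    pminor (insert m J) (tridiag a b) \<ge> a / 2 * pminor J (tridiag a b)"
  using J
proof (induction J arbitrary: m rule: finite_linorder_max_induct)
  case empty
  then show ?case
    using ab pminor_insert_isolated[of "{}" m "tridiag a b"] by (simp add: tridiag_def[of a b m m])
next
  case (insert l J)
  let ?p = "\<lambda>J. pminor J (tridiag a b)"
  have "J \<subseteq> {..<l}" using insert.hyps by auto
  then have IH: "?p J > 0" "?p (insert l J) \<ge> a / 2 * ?p J" using insert.IH by auto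
  then have pos: "?p (insert l J) > 0" using ab by (smt (verit) half_gt_zero zero_less_mult_iff)
  have l: "l < m" "l \<notin> J" using insert by auto
  show ?case
  proof (cases "m = Suc l")
    case True
    have eq: "?p (insert m (insert l J)) = a * ?p (insert l J) - b * b * ?p J"
      using insert l True
      by (subst pminor_insert_leaf[where k = l]) (auto simp: tridiag_def)
    \<comment> \<open>The subtracted term uses at most half of the diagonal one:
      \<open>b * b\<close> is below \<open>(a / 2)\<close> squared, and the induction hypothesis
      absorbs one factor \<open>a / 2\<close>.\<close>
    have "b * b * ?p J \<le> (a / 2) * ((a / 2) * ?p J)"
      using ab IH by (simp add: power2_eq_square)
    also have "\<dots> \<le> (a / 2) * ?p (insert l J)"
      using ab IH by (intro mult_left_mono) auto
    finally show ?thesis using eq pos by (simp add: field_simps)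
  next
    case False
    have "?p (insert m (insert l J)) = a * ?p (insert l J)"
      using insert l False
      by (subst pminor_insert_isolated) (force simp: tridiag_def)+
    then show ?thesis using pos ab by simp
  qed
qed

lemma pminor_tridiag_pos:
  assumes "a > 0" "a\<^sup>2 > 4 * b\<^sup>2" "finite J"
  shows "pminor J (tridiag a b) > 0"
proof -
  obtain m where "J \<subseteq> {..<m}" using assms(3) finite_nat_bounded by blast
  then show ?thesis using pminor_tridiag_insert_ge[OF assms] by blast
qed

lemma pminor_tridiag_ge_power:
  assumes "a > 0" "a\<^sup>2 > 4 * b\<^sup>2"
  shows "pminor {..<n} (tridiag a b) \<ge> (a / 2) ^ n"
proof (induction n)
  case (Suc n)
  have "(a / 2) * (a / 2) ^ n \<le> (a / 2) * pminor {..<n} (tridiag a b)"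
    using assms Suc by (intro mult_left_mono) auto
  also have "\<dots> \<le> pminor (insert n {..<n}) (tridiag a b)"
    using pminor_tridiag_insert_ge[OF assms, of "{..<n}" n] by auto
  finally show ?case by (simp add: lessThan_Suc)
qed simp

lemma tridiag_sym: "tridiag a b i j = tridiag a b j i"
  by (auto simp: tridiag_def)

text \<open>Inverting permutations exchanges the conditions \<open>p j = i\<close> and
  \<open>p i = j\<close>, keeps the sign, and transposes each factor, which symmetry of
  \<open>A\<close> undoes.\<close>

lemma pcof_sym:
  assumes J: "finite J" and A: "\<And>i j. A i j = A j i"
  shows "pcof J A j i = pcof J A i j"
  unfolding pcof_def
proof (rule sum.reindex_bij_witness[where j = Hilbert_Choice.inv and i = Hilbert_Choice.inv])
  fix p assume "p \<in> {p. p permutes J \<and> p j = i}"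
  then have p: "p permutes J" "p j = i" by auto
  show "Hilbert_Choice.inv (Hilbert_Choice.inv p) = p" "Hilbert_Choice.inv p \<in> {p. p permutes J \<and> p i = j}"
    using p by (auto simp: permutes_inv permutes_inv_inv permutes_inverses)
  have "p ` (J - {j}) = J - {i}"
    using p permutes_image[OF p(1)] by (simp add: image_set_diff permutes_inj)
  then have "bij_betw p (J - {j}) (J - {i})"
    using permutes_inj_on[OF p(1)] by (simp add: bij_betw_def)
  then have "(\<Prod>k\<in>J - {i}. A k (Hilbert_Choice.inv p k)) = (\<Prod>k\<in>J - {j}. A (p k) (Hilbert_Choice.inv p (p k)))"
    by (rule prod.reindex_bij_betw[symmetric])
  also have "\<dots> = (\<Prod>k\<in>J - {j}. A k (p k))"
    using p A by (simp add: permutes_inverses)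
  finally show "of_int (sign (Hilbert_Choice.inv p)) * (\<Prod>k\<in>J - {i}. A k (Hilbert_Choice.inv p k)) =
      of_int (sign p) * (\<Prod>k\<in>J - {j}. A k (p k))"
    using p(1) J permutation_permutes by (subst sign_inverse) auto
next
  fix p assume "p \<in> {p. p permutes J \<and> p i = j}"
  then have p: "p permutes J" "p i = j" by auto
  then show "Hilbert_Choice.inv (Hilbert_Choice.inv p) = p" "Hilbert_Choice.inv p \<in> {p. p permutes J \<and> p j = i}"
    by (auto simp: permutes_inv permutes_inv_inv permutes_inverses)
qed

text \<open>
  If \<open>p\<close> maps the least index \<open>i\<close> to the greatest \<open>j\<close>, then going down from \<open>j\<close> each index has only
  its predecessor left as a neighbouring image.
\<close>

lemma corner_permutation:
  assumes p: "p permutes J" "p i = j" and J: "J \<subseteq> {i..j}" "j \<in> J"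
    and nz: "\<And>k. k \<in> J \<Longrightarrow> k \<noteq> i \<Longrightarrow> tridiag a b k (p k) \<noteq> 0"
  shows "n \<le> j - i \<Longrightarrow> j - n \<in> J \<and> (n > 0 \<longrightarrow> p (Suc (j - n)) = j - n)"
proof (induction n rule: less_induct)
  case (less n)
  show ?case
  proof (cases n)
    case 0
    then show ?thesis using J by simp
  next
    case (Suc n')
    define k where "k = j - n'"
    have k: "k \<in> J" "n' > 0 \<Longrightarrow> p (Suc k) = k" "i < k" "j - n = k - 1" "k \<le> j"
      using less.IH[of n'] less.prems Suc by (auto simp: k_def)
    have inj: "p x = p y \<Longrightarrow> x = y" for x y using permutes_inj[OF p(1)] by (rule injD)
    have "tridiag a b k (p k) \<noteq> 0" using nz k by auto
    then have "p k = k \<or> \<bar>int k - int (p k)\<bar> = 1"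
      by (auto simp: tridiag_def split: if_splits)
    then consider "p k = k - 1" | "p k = k" | "p k = Suc k"
      by (cases "p k < k"; cases "p k = k") (auto simp: abs_if split: if_splits)
    \<comment> \<open>The other two images are taken already: \<open>k\<close> is the image of
      \<open>Suc k\<close>, or of \<open>i\<close> when \<open>k = j\<close>; \<open>Suc k\<close>
      is the image of \<open>Suc (Suc k)\<close>, or of \<open>i\<close> when
      \<open>Suc k = j\<close>.\<close>
    then have "p k = k - 1"
    proof cases
      case 2
      show ?thesis
      proof (cases "n' = 0")
        case True
        then have "p k = p i" using 2 p(2) by (simp add: k_def)
        then show ?thesis using inj k(3) by blast
      next
        case False
        then have "p (Suc k) = p k" using 2 k(2) by simp
        then show ?thesis using inj[of "Suc k" k] by simp
      qed
    next
      case 3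
      have "p k \<in> J" using permutes_in_image[OF p(1)] k(1) by simp
      then have "Suc k \<le> j" using 3 J by auto
      then have n': "n' > 0" by (auto simp: k_def)
      show ?thesis
      proof (cases "Suc k = j")
        case True
        then have "p k = p i" using 3 p(2) by simp
        then show ?thesis using inj k(3) by blast
      next
        case False
        then have "n' > 1" using \<open>Suc k \<le> j\<close> by (simp add: k_def)
        then have "p (Suc (j - (n' - 1))) = j - (n' - 1)"
          using less.IH[of "n' - 1"] less.prems Suc by simp
        moreover have "j - (n' - 1) = Suc k" using less.prems Suc n' by (simp add: k_def)
        ultimately have "p (Suc (Suc k)) = p k" using 3 by simp
        then show ?thesis using inj[of "Suc (Suc k)" k] by simp
      qed
    qed
    moreover have "p k \<in> J" using permutes_in_image[OF p(1)] k(1) by simp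
    moreover have "Suc (k - 1) = k" using k(3) by simp
    ultimately show ?thesis unfolding k(4) by simp
  qed
qed

text \<open>A nonzero term would come from a permutation that, by \<open>corner_permutation\<close>,
  descends through every index from \<open>j\<close> to \<open>i\<close>, so \<open>J\<close> could
  not have a gap.\<close>

lemma pcof_tridiag_gap:
  assumes J: "J \<subset> {i..j}" "j \<in> J"
  shows "pcof J (tridiag a b) i j = 0"
  unfolding pcof_def
proof (rule sum.neutral, rule)
  fix p assume "p \<in> {p. p permutes J \<and> p i = j}"
  then have p: "p permutes J" "p i = j" by auto
  have "\<exists>k\<in>J - {i}. tridiag a b k (p k) = 0"
  proof (rule ccontr)
    assume "\<not> ?thesis"
    then have nz: "\<And>k. k \<in> J \<Longrightarrow> k \<noteq> i \<Longrightarrow> tridiag a b k (p k) \<noteq> 0" by auto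
    have "k \<in> J" if "k \<in> {i..j}" for k
    proof -
      have "J \<subseteq> {i..j}" "j - k \<le> j - i" "j - (j - k) = k" using J(1) that by auto
      then show ?thesis using corner_permutation[OF p _ J(2) nz, of "j - k"] by simp
    qed
    then show False using J(1) by auto
  qed
  then have "(\<Prod>k\<in>J - {i}. tridiag a b k (p k)) = 0"
    using J finite_subset[of J "{i..j}"] by (intro prod_zero) auto
  then show "of_int (sign p) * (\<Prod>k\<in>J - {i}. tridiag a b k (p k)) = 0" by simp
qed

lemma abs_pcof_tridiag_interval:
  assumes "i \<le> j"
  shows "\<bar>pcof {i..j} (tridiag a b) i j\<bar> = \<bar>b\<bar> ^ (j - i)"
proof -
  \<comment> \<open>The cycle sending \<open>i\<close> to \<open>j\<close> and every other index of
    the interval one down; it is the only permutation with a possibly nonzero term, and all its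
    factors are \<open>b\<close>.\<close>
  define c where "c k = (if k = i then j else if k \<in> {i<..j} then k - 1 else k)" for k
  have c: "c permutes {i..j}"
  proof (rule inj_imp_permutes)
    show "inj_on c {i..j}" using assms by (auto simp: c_def inj_on_def split: if_splits)
  qed (use assms in \<open>auto simp: c_def\<close>)
  have "c i = j" by (simp add: c_def)
  let ?t = "\<lambda>p. of_int (sign p) * (\<Prod>k\<in>{i..j} - {i}. tridiag a b k (p k))"
  have "pcof {i..j} (tridiag a b) i j = sum ?t {c}"
    unfolding pcof_def
  proof (rule sum.mono_neutral_right)
    show "\<forall>p\<in>{p. p permutes {i..j} \<and> p i = j} - {c}. ?t p = 0"
    proof
      fix p assume "p \<in> {p. p permutes {i..j} \<and> p i = j} - {c}"
      then have p: "p permutes {i..j}" "p i = j" "p \<noteq> c" by auto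
      have "\<exists>k\<in>{i..j} - {i}. tridiag a b k (p k) = 0"
      proof (rule ccontr)
        assume "\<not> ?thesis"
        then have nz: "\<And>k. k \<in> {i..j} \<Longrightarrow> k \<noteq> i \<Longrightarrow> tridiag a b k (p k) \<noteq> 0" by auto
        have down: "p k = k - 1" if "k \<in> {i<..j}" for k
        proof -
          \<comment> \<open>Taking \<open>Suc j - k\<close> descending steps in
            \<open>corner_permutation\<close> reaches \<open>k - 1\<close>, whose preimage is
            \<open>k\<close>.\<close>
          have "Suc j - k \<le> j - i" "j - (Suc j - k) = k - 1" "Suc j - k > 0" "Suc (k - 1) = k"
            using that by auto
          then show ?thesis
            using corner_permutation[OF p(1,2) order.refl _ nz, of "Suc j - k"] assms by simp
        qed
        have out: "p k = k" if "k \<notin> {i..j}" for k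
          using p(1) that by (rule permutes_not_in)
        have "p k = c k" for k
        proof -
          consider "k = i" | "k \<in> {i<..j}" | "k \<notin> {i..j}" by fastforce
          then show ?thesis
          proof cases
            case 3
            then have "c k = k" using assms by (auto simp: c_def)
            then show ?thesis using out[OF 3] by simp
          qed (use p(2) down in \<open>simp_all add: c_def\<close>)
        qed
        then have "p = c" by (rule ext)
        then show False using p by simp
      qed
      then have "(\<Prod>k\<in>{i..j} - {i}. tridiag a b k (p k)) = 0" by (intro prod_zero) auto
      then show "?t p = 0" by simp
    qed
  qed (use c \<open>c i = j\<close> in \<open>auto intro!: finite_subset[OF _ finite_permutations[of "{i..j}"]]\<close>)
  moreover have "(\<Prod>k\<in>{i..j} - {i}. tridiag a b k (c k)) = (\<Prod>k\<in>{i..j} - {i}. b)"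
    by (intro prod.cong refl) (auto simp: c_def tridiag_def)
  ultimately show ?thesis
    using assms by (simp add: abs_mult power_abs sign_def)
qed

subsection \<open>The Hessian of the expected log-likelihood\<close>

lemma dminor_cong:
  assumes "\<And>i j. i \<in> J \<Longrightarrow> j \<in> J \<Longrightarrow> A i j = B i j"
    and "\<And>i j. i \<in> J \<Longrightarrow> j \<in> J \<Longrightarrow> H i j = K i j"
  shows "dminor J A H = dminor J B K"
  unfolding dminor_def using assms
  by (intro sum.cong refl arg_cong2[where f = "(*)"] prod.cong) (auto simp: permutes_in_image)

lemma dminor_add: "dminor J A (\<lambda>i j. H i j + K i j) = dminor J A H + dminor J A K"
  by (simp add: dminor_def distrib_left distrib_right sum.distrib)

lemma dminor_cmult: "dminor J A (\<lambda>i j. c * H i j) = c * dminor J A H"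
  by (simp add: dminor_def sum_distrib_left mult_ac)

text \<open>
  Bounded functions on \<^typ>\<open>nat\<close> are a normed space into which the matrices of every dimension
  embed linearly with norm at most \<^const>\<open>frobenius_norm\<close>; this makes the library's
  derivative rules available.
\<close>

definition coord :: "(nat \<Rightarrow>\<^sub>C real) \<Rightarrow> nat \<Rightarrow> nat \<Rightarrow> real" where
  "coord x i j = apply_bcontfun x (prod_encode (i, j))"

definition mat_embed :: "nat \<Rightarrow> real mat \<Rightarrow> (nat \<Rightarrow>\<^sub>C real)" where
  "mat_embed N M =
     Bcontfun (\<lambda>n. case prod_decode n of (i, j) \<Rightarrow> if i < N \<and> j < N then M $$ (i, j) else 0)"

lemma coord_embed: "coord (mat_embed N M) i j = (if i < N \<and> j < N then M $$ (i, j) else 0)"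
proof -
  let ?f = "\<lambda>n. case prod_decode n of (i, j) \<Rightarrow> if i < N \<and> j < N then M $$ (i, j) else 0"
  \<comment> \<open>A finite range makes the function bounded, and on \<open>nat\<close> continuity
    is automatic.\<close>
  have "range ?f \<subseteq> insert 0 ((\<lambda>ij. M $$ ij) ` ({..<N} \<times> {..<N}))"
    by (auto split: prod.splits)
  then have "finite (range ?f)" by (rule finite_subset) auto
  then have "?f \<in> bcontfun"
    by (simp add: bcontfun_def finite_imp_bounded)
  then have "apply_bcontfun (mat_embed N M) = ?f"
    unfolding mat_embed_def by (rule Bcontfun_inverse)
  then show ?thesis by (simp add: coord_def)
qed

lemma coord_eqI:
  assumes "\<And>i j. coord x i j = coord y i j"
  shows "x = y"
proof (rule bcontfun_eqI)
  fix n
  show "apply_bcontfun x n = apply_bcontfun y n"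
    using assms[of "fst (prod_decode n)" "snd (prod_decode n)"] by (simp add: coord_def)
qed

lemma coord_add: "coord (x + y) i j = coord x i j + coord y i j"
  and coord_scaleR: "coord (c *\<^sub>R x) i j = c * coord x i j"
  by (simp_all add: coord_def)

lemma bounded_linear_coord: "bounded_linear (\<lambda>x. coord x i j)"
proof (rule bounded_linear_intro[where K = 1])
  show "norm (coord x i j) \<le> norm x * 1" for x
    using norm_bounded[of x "prod_encode (i, j)"] by (simp add: coord_def)
qed (simp_all add: coord_add coord_scaleR)

lemma has_derivative_coord: "((\<lambda>x. coord x i j) has_derivative (\<lambda>h. coord h i j)) (at x)"
  by (rule bounded_linear.has_derivative[OF bounded_linear_coord has_derivative_ident])

lemma embed_add:
  assumes "H \<in> carrier_mat N N" "K \<in> carrier_mat N N"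
  shows "mat_embed N (H + K) = mat_embed N H + mat_embed N K"
  using assms by (intro coord_eqI) (auto simp: coord_embed coord_add)

lemma embed_smult:
  assumes "H \<in> carrier_mat N N"
  shows "mat_embed N (c \<cdot>\<^sub>m H) = c *\<^sub>R mat_embed N H"
  using assms by (intro coord_eqI) (auto simp: coord_embed coord_scaleR)

lemma abs_entry_le_frobenius_norm:
  assumes "i < dim_row H" "j < dim_col H"
  shows "\<bar>H $$ (i, j)\<bar> \<le> frobenius_norm H"
proof -
  have "(H $$ (i, j))\<^sup>2 \<le> (\<Sum>j<dim_col H. (H $$ (i, j))\<^sup>2)"
    using assms by (intro member_le_sum) auto
  also have "\<dots> \<le> (\<Sum>i<dim_row H. \<Sum>j<dim_col H. (H $$ (i, j))\<^sup>2)"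
    using assms by (intro member_le_sum[where f = "\<lambda>i. \<Sum>j<dim_col H. (H $$ (i, j))\<^sup>2"])
      (auto intro: sum_nonneg)
  finally show ?thesis
    unfolding frobenius_norm_def by (intro real_le_rsqrt) simp
qed

text \<open>No single entry exceeds the Frobenius norm. This one-sided comparison suffices for the
  transfer: a small \<open>frobenius_norm\<close> keeps the embedded point in the neighbourhood, and
  the error bound only grows.\<close>

lemma norm_embed_le:
  assumes "H \<in> carrier_mat N N"
  shows "norm (mat_embed N H) \<le> frobenius_norm H"
proof (rule norm_bound)
  fix n
  obtain i j where n: "n = prod_encode (i, j)" by (metis prod_decode_inverse surj_pair)
  have "norm (apply_bcontfun (mat_embed N H) n) = \<bar>coord (mat_embed N H) i j\<bar>"
    by (simp add: coord_def n)
  also have "\<dots> \<le> frobenius_norm H"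
    using assms abs_entry_le_frobenius_norm[of i H j]
    by (auto simp: coord_embed frobenius_norm_nonneg)
  finally show "norm (apply_bcontfun (mat_embed N H) n) \<le> frobenius_norm H" .
qed

definition unit_entry :: "nat \<Rightarrow> nat \<Rightarrow> nat \<Rightarrow> (nat \<Rightarrow>\<^sub>C real)" where
  "unit_entry N i j = mat_embed N (Matrix.mat N N (\<lambda>ij. if ij = (i, j) then 1 else 0))"

lemma embed_eq_sum_unit_entry:
  assumes H: "H \<in> carrier_mat N N"
  shows "mat_embed N H = (\<Sum>(i, j)\<in>{..<N} \<times> {..<N}. H $$ (i, j) *\<^sub>R unit_entry N i j)"
proof (rule coord_eqI)
  fix k l
  interpret bounded_linear "\<lambda>x. coord x k l" by (rule bounded_linear_coord)
  have "coord (\<Sum>(i, j)\<in>{..<N} \<times> {..<N}. H $$ (i, j) *\<^sub>R unit_entry N i j) k l =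
      (\<Sum>(i, j)\<in>{..<N} \<times> {..<N}. H $$ (i, j) * coord (unit_entry N i j) k l)"
    by (simp add: sum scaleR case_prod_beta)
  also have "\<dots> = (\<Sum>ij\<in>{..<N} \<times> {..<N}. if ij = (k, l) then H $$ (k, l) else 0)"
    by (intro sum.cong) (auto simp: unit_entry_def coord_embed split: prod.splits)
  also have "\<dots> = coord (mat_embed N H) k l"
    by (simp add: coord_embed)
  finally show "coord (mat_embed N H) k l =
      coord (\<Sum>(i, j)\<in>{..<N} \<times> {..<N}. H $$ (i, j) *\<^sub>R unit_entry N i j) k l" by simp
qed

lemma sym_mats_carrier: "H \<in> sym_mats N \<Longrightarrow> H \<in> carrier_mat N N"
  by (simp add: sym_mats_def)

lemma linear_on_sym_embed:
  assumes "linear f"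
  shows "linear_on_sym N (\<lambda>H. f (mat_embed N H))"
  unfolding linear_on_sym_def
  by (auto simp: embed_add embed_smult sym_mats_carrier linear_add[OF assms] linear_scale[OF assms])

lemma has_derivative_sym_embed:
  assumes g: "(g has_derivative g') (at (mat_embed N M))" and M: "M \<in> sym_mats N"
    and f: "\<And>K. K \<in> sym_mats N \<Longrightarrow> f K = g (mat_embed N K)"
  shows "has_derivative_sym N f M (\<lambda>H. g' (mat_embed N H))"
  unfolding has_derivative_sym_def
proof (intro conjI allI impI)
  show "linear_on_sym N (\<lambda>H. g' (mat_embed N H))"
    using g by (intro linear_on_sym_embed) (rule has_derivative_linear)
  fix e :: real assume e: "e > 0"
  obtain d where d: "d > 0" "\<And>y. norm (y - mat_embed N M) < d \<Longrightarrow>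
      norm (g y - g (mat_embed N M) - g' (y - mat_embed N M)) \<le> e * norm (y - mat_embed N M)"
    using g e unfolding has_derivative_at_alt by blast
  have "\<bar>f (M + H) - f M - g' (mat_embed N H)\<bar> \<le> e * frobenius_norm H"
    if H: "H \<in> sym_mats N" "frobenius_norm H < d" for H
  proof -
    have n: "norm (mat_embed N H) \<le> frobenius_norm H" using H sym_mats_carrier norm_embed_le by blast
    have "\<bar>g (mat_embed N M + mat_embed N H) - g (mat_embed N M) - g' (mat_embed N H)\<bar> \<le> e * norm (mat_embed N H)"
      using d(2)[of "mat_embed N M + mat_embed N H"] n H(2) by simp
    also have "\<dots> \<le> e * frobenius_norm H" using n e by simp
    finally show ?thesis
      using f[OF M] f[OF sym_mats_closed(2)[OF H(1) M]] H M
      by (simp add: embed_add sym_mats_carrier)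
  qed
  then show "\<exists>d>0. \<forall>H\<in>sym_mats N. frobenius_norm H < d \<longrightarrow>
      \<bar>f (M + H) - f M - g' (mat_embed N H)\<bar> \<le> e * frobenius_norm H"
    using d(1) by blast
qed

text \<open>Hypothesis \<open>B\<close> differentiates \<open>G\<close> for each fixed direction
  \<open>h\<close> separately, whereas the conclusion needs an error uniform in \<open>H\<close>.
  The error is linear in the direction, so it is enough to control it on the finitely many
  \<open>unit_entry\<close> vectors, with one common radius.\<close>

lemma has_second_derivative_sym_embed:
  assumes L: "L \<in> sym_mats N" and r: "r > 0"
    and f: "\<And>K. K \<in> sym_mats N \<Longrightarrow> f K = g (mat_embed N K)"
    and G: "\<And>x. norm (x - mat_embed N L) < r \<Longrightarrow> (g has_derivative G x) (at x)"
    and B: "\<And>h. ((\<lambda>x. G x h) has_derivative (\<lambda>k. B k h)) (at (mat_embed N L))"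
    and lin: "\<And>k. linear (B k)"
  shows "has_second_derivative_sym N f L (\<lambda>K H. B (mat_embed N K) (mat_embed N H))"
  unfolding has_second_derivative_sym_def
proof (intro conjI)
  show "bilinear_on_sym N (\<lambda>K H. B (mat_embed N K) (mat_embed N H))"
    unfolding bilinear_on_sym_def
    using linear_on_sym_embed[OF lin] linear_on_sym_embed[OF has_derivative_linear[OF B]] by blast
next
  let ?D = "\<lambda>M H. G (mat_embed N M) (mat_embed N H)"
  have D: "has_derivative_sym N f M (?D M)" if M: "M \<in> sym_mats N" "frobenius_norm (M - L) < r" for M
  proof -
    have "mat_embed N M - mat_embed N L = mat_embed N (M - L)"
      using M L by (intro coord_eqI)
        (auto simp: coord_embed sym_mats_def coord_def[of "_ - _"] coord_def[symmetric])
    then have "norm (mat_embed N M - mat_embed N L) \<le> frobenius_norm (M - L)"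
      using norm_embed_le[of "M - L" N] M L by (simp add: sym_mats_def minus_carrier_mat)
    then show "has_derivative_sym N f M (\<lambda>H. G (mat_embed N M) (mat_embed N H))"
      using M f G by (intro has_derivative_sym_embed[where g = g]) auto
  qed
  let ?x = "mat_embed N L" and ?I = "{..<N} \<times> {..<N}"
  have small: "\<exists>d>0. \<forall>K\<in>sym_mats N. frobenius_norm K < d \<longrightarrow> (\<forall>H\<in>sym_mats N.
      \<bar>?D (L + K) H - ?D L H - B (mat_embed N K) (mat_embed N H)\<bar>
        \<le> e * frobenius_norm K * frobenius_norm H)" if e: "e > 0" for e :: real
  proof -
    \<comment> \<open>The errors of \<open>N * N\<close> unit directions are added, hence the
      division; the \<open>+ 1\<close> keeps the denominator positive for
      \<open>N = 0\<close>.\<close>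
    define e' where "e' = e / (real (N * N) + 1)"
    have e': "e' > 0" "real (N * N) * e' \<le> e" using e
      by (auto simp: e'_def pos_divide_le_eq algebra_simps add_pos_nonneg intro!: divide_pos_pos)
    have "\<forall>ij\<in>?I. \<forall>\<^sub>F y in nhds ?x. case ij of (i, j) \<Rightarrow>
        \<bar>G y (unit_entry N i j) - G ?x (unit_entry N i j) - B (y - ?x) (unit_entry N i j)\<bar>
          \<le> e' * norm (y - ?x)"
    proof safe
      fix i j
      show "\<forall>\<^sub>F y in nhds ?x. \<bar>G y (unit_entry N i j) - G ?x (unit_entry N i j)
          - B (y - ?x) (unit_entry N i j)\<bar> \<le> e' * norm (y - ?x)"
        using B[of "unit_entry N i j"] e'(1)
        unfolding has_derivative_at_alt eventually_nhds_metric dist_norm real_norm_def by blast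
    qed
    then have "\<forall>\<^sub>F y in nhds ?x. \<forall>ij\<in>?I. case ij of (i, j) \<Rightarrow>
        \<bar>G y (unit_entry N i j) - G ?x (unit_entry N i j) - B (y - ?x) (unit_entry N i j)\<bar>
          \<le> e' * norm (y - ?x)"
      by (intro eventually_ball_finite) auto
    then obtain d where d: "d > 0" "\<And>y i j. norm (y - ?x) < d \<Longrightarrow> i < N \<Longrightarrow> j < N \<Longrightarrow>
        \<bar>G y (unit_entry N i j) - G ?x (unit_entry N i j) - B (y - ?x) (unit_entry N i j)\<bar>
          \<le> e' * norm (y - ?x)"
      unfolding eventually_nhds_metric dist_norm by fastforce
    show ?thesis
    proof (intro exI[of _ "min d r"] conjI ballI impI)
      fix K H assume K: "K \<in> sym_mats N" "frobenius_norm K < min d r" and H: "H \<in> sym_mats N"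
      let ?k = "mat_embed N K" and ?n = "frobenius_norm K" and ?m = "frobenius_norm H"
      have k: "norm ?k \<le> ?n" using K norm_embed_le sym_mats_carrier by blast
      define D where "D h = G (?x + ?k) h - G ?x h - B ?k h" for h
      have linD: "linear D"
        unfolding D_def
        using has_derivative_linear[OF G[of "?x + ?k"]] has_derivative_linear[OF G[of ?x]] lin k K(2) r
        by (intro linear_compose_sub) auto
      have "D (mat_embed N H) = (\<Sum>(i, j)\<in>?I. H $$ (i, j) * D (unit_entry N i j))"
        using H by (subst embed_eq_sum_unit_entry)
          (auto simp: sym_mats_carrier linear_sum[OF linD] linear_scale[OF linD] case_prod_beta)
      also have "\<bar>\<dots>\<bar> \<le> (\<Sum>ij\<in>?I. ?m * (e' * ?n))"
      proof (intro order.trans[OF sum_abs] sum_mono)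
        fix ij assume "ij \<in> ?I"
        then obtain i j where ij: "ij = (i, j)" "i < N" "j < N" by auto
        have "\<bar>D (unit_entry N i j)\<bar> \<le> e' * norm ?k"
          using d(2)[of "?x + ?k" i j] ij k K(2) by (simp add: D_def)
        also have "\<dots> \<le> e' * ?n" using k e' by simp
        finally have "\<bar>D (unit_entry N i j)\<bar> \<le> e' * ?n" .
        moreover have "\<bar>H $$ (i, j)\<bar> \<le> ?m"
          using H ij by (intro abs_entry_le_frobenius_norm) (auto simp: sym_mats_def)
        ultimately show "\<bar>case ij of (i, j) \<Rightarrow> H $$ (i, j) * D (unit_entry N i j)\<bar> \<le> ?m * (e' * ?n)"
          unfolding ij prod.case abs_mult by (intro mult_mono) (auto simp: frobenius_norm_nonneg)
      qed
      also have "\<dots> = (real (N * N) * e') * (?n * ?m)"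
        by (simp add: mult_ac)
      also have "\<dots> \<le> e * (?n * ?m)"
        using e'(2) by (intro mult_right_mono) (auto simp: frobenius_norm_nonneg)
      finally show "\<bar>G (mat_embed N (L + K)) (mat_embed N H) - G ?x (mat_embed N H) - B ?k (mat_embed N H)\<bar>
          \<le> e * ?n * ?m"
        using K L by (simp add: D_def embed_add sym_mats_carrier mult_ac)
    qed (use d r in auto)
  qed
  show "\<exists>D. \<exists>r>0.
      (\<forall>M\<in>sym_mats N. frobenius_norm (M - L) < r \<longrightarrow> has_derivative_sym N f M (D M)) \<and>
      (\<forall>e>0. \<exists>d>0. \<forall>K\<in>sym_mats N. frobenius_norm K < d \<longrightarrow> (\<forall>H\<in>sym_mats N.
        \<bar>D (L + K) H - D L H - B (mat_embed N K) (mat_embed N H)\<bar>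
          \<le> e * frobenius_norm K * frobenius_norm H))"
    using r D small by (intro exI[of _ ?D] exI[of _ r]) blast
qed

section \<open>Derivatives of minors and of the log-likelihood\<close>

lemma has_derivative_pminor:
  "((\<lambda>x. pminor J (coord x)) has_derivative (\<lambda>h. dminor J (coord x) (coord h))) (at x)"
  unfolding pminor_def dminor_def
  by (intro has_derivative_sum has_derivative_mult_right has_derivative_prod has_derivative_coord)

text \<open>Existence is enough, because the second derivatives of the minors cancel in
  \<open>has_derivative_score_diff\<close>.\<close>

lemma dminor_differentiable:
  "\<exists>D. ((\<lambda>x. dminor J (coord x) H) has_derivative D) (at x)"
  unfolding dminor_def
  by (rule exI,
    (rule has_derivative_sum has_derivative_mult_right has_derivative_prod has_derivative_coord)+)

text \<open>The logarithmic derivative of the minor along \<open>H\<close>; for a nonzero minor it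
  is the trace of the inverse of \<open>A\<close> restricted to \<open>J\<close>, times
  \<open>H\<close> restricted to \<open>J\<close>.\<close>

definition score :: "nat set \<Rightarrow> (nat \<Rightarrow> nat \<Rightarrow> real) \<Rightarrow> (nat \<Rightarrow> nat \<Rightarrow> real) \<Rightarrow> real" where
  "score J A H = dminor J A H / pminor J A"

lemma score_cong:
  assumes "\<And>i j. i \<in> J \<Longrightarrow> j \<in> J \<Longrightarrow> A i j = B i j"
    and "\<And>i j. i \<in> J \<Longrightarrow> j \<in> J \<Longrightarrow> H i j = K i j"
  shows "score J A H = score J B K"
  using dminor_cong[OF assms] pminor_cong[OF assms(1)] by (simp add: score_def)

lemma linear_score_coord: "linear (\<lambda>h. score J A (coord h))"
proof
  have add: "coord (x + y) = (\<lambda>i j. coord x i j + coord y i j)" for x y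
    by (simp add: coord_add fun_eq_iff)
  have scale: "coord (c *\<^sub>R x) = (\<lambda>i j. c * coord x i j)" for c x
    by (simp add: coord_scaleR fun_eq_iff)
  show "score J A (coord (x + y)) = score J A (coord x) + score J A (coord y)" for x y
    by (simp add: score_def add dminor_add add_divide_distrib)
  show "score J A (coord (c *\<^sub>R x)) = c *\<^sub>R score J A (coord x)" for c x
    by (simp add: score_def scale dminor_cmult)
qed

lemma linear_weighted_score_coord: "linear (\<lambda>h. \<Sum>J\<in>S. w J * score J A (coord h))"
  by (rule linearI)
    (simp_all add: linear_add[OF linear_score_coord] linear_scale[OF linear_score_coord]
      distrib_left sum.distrib sum_distrib_left mult_ac)

lemma has_derivative_log_pminor_sum:
  assumes S: "finite S" "S \<noteq> {}" and pos: "\<And>J. J \<in> S \<Longrightarrow> pminor J (coord x) > 0"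
  shows "((\<lambda>x. (\<Sum>J\<in>S. w J * ln (pminor J (coord x))) - ln (\<Sum>J\<in>S. pminor J (coord x)))
    has_derivative (\<lambda>h. (\<Sum>J\<in>S. w J * score J (coord x) (coord h)) -
      (\<Sum>J\<in>S. dminor J (coord x) (coord h)) / (\<Sum>J\<in>S. pminor J (coord x)))) (at x)"
proof -
  have "(\<Sum>J\<in>S. pminor J (coord x)) > 0" using S pos by (intro sum_pos) auto
  then show ?thesis
    unfolding score_def divide_inverse
    by (intro has_derivative_diff has_derivative_sum has_derivative_mult_right has_derivative_ln
        has_derivative_pminor pos)
qed

text \<open>With \<open>w J\<close> equal to the minor divided by the normalising sum, the unknown
  second derivatives \<open>D J k\<close> enter both quotient rules with the same factor and cancel.
  Only products of first derivatives remain, and they form minus a covariance.\<close>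

lemma has_derivative_score_diff:
  assumes S: "finite S" "S \<noteq> {}" and pos: "\<And>J. J \<in> S \<Longrightarrow> pminor J (coord x0) > 0"
    and w: "\<And>J. J \<in> S \<Longrightarrow> w J = pminor J (coord x0) / (\<Sum>J\<in>S. pminor J (coord x0))"
  shows "((\<lambda>x. (\<Sum>J\<in>S. w J * score J (coord x) (coord h)) -
      (\<Sum>J\<in>S. dminor J (coord x) (coord h)) / (\<Sum>J\<in>S. pminor J (coord x)))
    has_derivative (\<lambda>k.
      (\<Sum>J\<in>S. w J * score J (coord x0) (coord k)) * (\<Sum>J\<in>S. w J * score J (coord x0) (coord h)) -
      (\<Sum>J\<in>S. w J * (score J (coord x0) (coord k) * score J (coord x0) (coord h))))) (at x0)"
proof -
  let ?m = "\<lambda>J. pminor J (coord x0)" and ?d = "\<lambda>J h. dminor J (coord x0) (coord h)"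
  let ?Z = "\<Sum>J\<in>S. ?m J"
  have Z: "?Z > 0" using S pos by (intro sum_pos) auto
  have "\<forall>J. \<exists>D. ((\<lambda>x. dminor J (coord x) (coord h)) has_derivative D) (at x0)"
    using dminor_differentiable by blast
  then obtain D where D: "\<And>J. ((\<lambda>x. dminor J (coord x) (coord h)) has_derivative D J) (at x0)"
    by metis
  have "((\<lambda>x. (\<Sum>J\<in>S. w J * score J (coord x) (coord h)) -
      (\<Sum>J\<in>S. dminor J (coord x) (coord h)) / (\<Sum>J\<in>S. pminor J (coord x)))
    has_derivative (\<lambda>k.
      (\<Sum>J\<in>S. w J * ((D J k * ?m J - ?d J h * ?d J k) / (?m J * ?m J))) -
      ((\<Sum>J\<in>S. D J k) * ?Z - (\<Sum>J\<in>S. ?d J h) * (\<Sum>J\<in>S. ?d J k)) / (?Z * ?Z))) (at x0)"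
    unfolding score_def using pos Z
    by (intro has_derivative_diff has_derivative_sum has_derivative_mult_right
        has_derivative_divide' has_derivative_pminor D) (auto simp: less_imp_neq[symmetric])
  moreover have "(\<Sum>J\<in>S. w J * ((D J k * ?m J - ?d J h * ?d J k) / (?m J * ?m J))) -
      ((\<Sum>J\<in>S. D J k) * ?Z - (\<Sum>J\<in>S. ?d J h) * (\<Sum>J\<in>S. ?d J k)) / (?Z * ?Z) =
      (\<Sum>J\<in>S. w J * score J (coord x0) (coord k)) * (\<Sum>J\<in>S. w J * score J (coord x0) (coord h)) -
      (\<Sum>J\<in>S. w J * (score J (coord x0) (coord k) * score J (coord x0) (coord h)))" for k
  proof -
    have "(\<Sum>J\<in>S. w J * ((D J k * ?m J - ?d J h * ?d J k) / (?m J * ?m J))) =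
        (\<Sum>J\<in>S. D J k / ?Z - w J * (score J (coord x0) (coord k) * score J (coord x0) (coord h)))"
      using pos Z by (intro sum.cong refl) (simp add: w score_def field_simps less_imp_neq[symmetric])
    also have "\<dots> = (\<Sum>J\<in>S. D J k) / ?Z -
        (\<Sum>J\<in>S. w J * (score J (coord x0) (coord k) * score J (coord x0) (coord h)))"
      by (simp add: sum_subtractf sum_divide_distrib)
    finally have 1: "(\<Sum>J\<in>S. w J * ((D J k * ?m J - ?d J h * ?d J k) / (?m J * ?m J))) =
      (\<Sum>J\<in>S. D J k) / ?Z -
        (\<Sum>J\<in>S. w J * (score J (coord x0) (coord k) * score J (coord x0) (coord h)))" .
    have 2: "(\<Sum>J\<in>S. w J * score J (coord x0) (coord h)) = (\<Sum>J\<in>S. ?d J h) / ?Z" for h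
      unfolding sum_divide_distrib using pos
      by (intro sum.cong refl) (simp add: w score_def less_imp_neq[symmetric])
    show ?thesis unfolding 1 2 using Z by (simp add: diff_divide_distrib)
  qed
  ultimately show ?thesis by simp
qed

text \<open>The Fisher information form of the process at \<open>L\<close>: the covariance of the
  scores along \<open>K\<close> and \<open>H\<close>.\<close>

definition score_cov :: "nat \<Rightarrow> real mat \<Rightarrow> real mat \<Rightarrow> real mat \<Rightarrow> real" where
  "score_cov N L K H =
    (let s = (\<lambda>J H. score J (\<lambda>i j. L $$ (i, j)) (\<lambda>i j. H $$ (i, j))) in
      (\<Sum>J\<in>Pow {..<N}. dpp_pmf N L J * (s J K * s J H)) -
      (\<Sum>J\<in>Pow {..<N}. dpp_pmf N L J * s J K) * (\<Sum>J\<in>Pow {..<N}. dpp_pmf N L J * s J H))"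

lemma dpp_pmf_eq:
  assumes "L \<in> carrier_mat N N" "J \<subseteq> {..<N}"
  shows "dpp_pmf N L J = pminor J (\<lambda>i j. L $$ (i, j)) /
    (\<Sum>J\<in>Pow {..<N}. pminor J (\<lambda>i j. L $$ (i, j)))"
  using assms by (simp add: dpp_pmf_def det_submatrix_eq_pminor det_identity_add)

lemma has_second_derivative_expected_log_likelihood:
  assumes L: "L \<in> sym_mats N"
    and pos: "\<And>J. J \<subseteq> {..<N} \<Longrightarrow> pminor J (\<lambda>i j. L $$ (i, j)) > 0"
  shows "has_second_derivative_sym N (expected_log_likelihood N L) L
    (\<lambda>K H. - score_cov N L K H)"
proof -
  let ?S = "Pow {..<N}" and ?x0 = "mat_embed N L" and ?w = "dpp_pmf N L"
  define g where "g x = (\<Sum>J\<in>?S. ?w J * ln (pminor J (coord x))) - ln (\<Sum>J\<in>?S. pminor J (coord x))" for x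
  define G where "G x h = (\<Sum>J\<in>?S. ?w J * score J (coord x) (coord h)) -
      (\<Sum>J\<in>?S. dminor J (coord x) (coord h)) / (\<Sum>J\<in>?S. pminor J (coord x))" for x h
  define B where "B k h =
      (\<Sum>J\<in>?S. ?w J * score J (coord ?x0) (coord k)) * (\<Sum>J\<in>?S. ?w J * score J (coord ?x0) (coord h)) -
      (\<Sum>J\<in>?S. ?w J * (score J (coord ?x0) (coord k) * score J (coord ?x0) (coord h)))" for k h
  have pm: "pminor J (coord (mat_embed N K)) = pminor J (\<lambda>i j. K $$ (i, j))" if "J \<in> ?S" for J K
    using that by (intro pminor_cong) (auto simp: coord_embed)
  have pos': "pminor J (coord ?x0) > 0" if "J \<in> ?S" for J
    using that pos pm by simp
  have w: "?w J = pminor J (coord ?x0) / (\<Sum>J\<in>?S. pminor J (coord ?x0))" if "J \<in> ?S" for J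
    using that L by (simp add: dpp_pmf_eq sym_mats_carrier pm)
  \<comment> \<open>The logarithms are differentiable only where the minors are positive.
    Continuity, applied to finitely many \<open>J\<close>, extends positivity from
    \<open>?x0\<close> to the ball of radius \<open>r\<close>.\<close>
  have "\<forall>J\<in>?S. \<forall>\<^sub>F x in nhds ?x0. pminor J (coord x) > 0"
  proof
    fix J assume J: "J \<in> ?S"
    have "isCont (\<lambda>x. pminor J (coord x)) ?x0"
      using has_derivative_continuous[OF has_derivative_pminor] .
    then have "((\<lambda>x. pminor J (coord x)) \<longlongrightarrow> pminor J (coord ?x0)) (nhds ?x0)"
      unfolding isCont_def by (rule tendsto_at_iff_tendsto_nhds[THEN iffD1])
    then show "\<forall>\<^sub>F x in nhds ?x0. pminor J (coord x) > 0"
      using pos'[OF J] by (rule order_tendstoD(1))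
  qed
  then have "\<forall>\<^sub>F x in nhds ?x0. \<forall>J\<in>?S. pminor J (coord x) > 0"
    by (intro eventually_ball_finite) auto
  then obtain r where r: "r > 0" "\<And>x J. norm (x - ?x0) < r \<Longrightarrow> J \<in> ?S \<Longrightarrow> pminor J (coord x) > 0"
    unfolding eventually_nhds_metric dist_norm by blast
  have "has_second_derivative_sym N (expected_log_likelihood N L) L
      (\<lambda>K H. B (mat_embed N K) (mat_embed N H))"
  proof (rule has_second_derivative_sym_embed[where g = g and G = G, OF L r(1)])
    show "expected_log_likelihood N L K = g (mat_embed N K)" if "K \<in> sym_mats N" for K
      using that by (simp add: expected_log_likelihood_def g_def pm
          det_submatrix_eq_pminor[OF sym_mats_carrier]
          det_identity_add sym_mats_carrier)
    show "(g has_derivative G x) (at x)" if "norm (x - ?x0) < r" for x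
      unfolding g_def G_def using r(2)[OF that]
      by (intro has_derivative_log_pminor_sum) auto
    show "((\<lambda>x. G x h) has_derivative (\<lambda>k. B k h)) (at ?x0)" for h
      unfolding G_def B_def using pos' w by (intro has_derivative_score_diff) auto
    show "linear (B k)" for k
    proof -
      \<comment> \<open>Freezing the mean score along \<open>k\<close> exhibits \<open>B k\<close>
        as a weighted sum of scores, which is visibly linear.\<close>
      define m where "m = (\<Sum>J\<in>?S. ?w J * score J (coord ?x0) (coord k))"
      have "B k = (\<lambda>h. \<Sum>J\<in>?S. (?w J * (m - score J (coord ?x0) (coord k))) * score J (coord ?x0) (coord h))"
        unfolding B_def m_def[symmetric]
        by (simp add: fun_eq_iff sum_distrib_left sum_subtractf[symmetric] algebra_simps)
      then show ?thesis by (simp add: linear_weighted_score_coord)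
    qed
  qed
  moreover have "B (mat_embed N K) (mat_embed N H) = - score_cov N L K H" for K H
  proof -
    have "score J (coord ?x0) (coord (mat_embed N H)) = score J (\<lambda>i j. L $$ (i, j)) (\<lambda>i j. H $$ (i, j))"
      if "J \<in> ?S" for J H
      using that by (intro score_cong) (auto simp: coord_embed)
    then show ?thesis by (simp add: B_def score_cov_def)
  qed
  ultimately show ?thesis by simp
qed

subsection \<open>Bounds on the score variance\<close>

lemma two_abs_less:
  assumes "a > 0" "a\<^sup>2 > 4 * b\<^sup>2"
  shows "2 * \<bar>b\<bar> < (a::real)"
proof (rule power2_less_imp_less)
  show "(2 * \<bar>b\<bar>)\<^sup>2 < a\<^sup>2" using assms by (simp add: power_mult_distrib)
qed (use assms in simp)

lemma tridiag_mat_carrier: "tridiag_mat N a b \<in> carrier_mat N N"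
  by (simp add: tridiag_mat_def)

lemma tridiag_mat_index: "i < N \<Longrightarrow> j < N \<Longrightarrow> tridiag_mat N a b $$ (i, j) = tridiag a b i j"
  by (simp add: tridiag_mat_def tridiag_def)

lemma tridiag_mat_sym: "tridiag_mat N a b \<in> sym_mats N"
  unfolding sym_mats_def
  by (auto intro!: eq_matI simp: tridiag_mat_carrier tridiag_mat_index tridiag_sym
      carrier_matD[OF tridiag_mat_carrier])

lemma sym_mats_index:
  assumes H: "H \<in> sym_mats N" and ij: "i < N" "j < N"
  shows "H $$ (i, j) = H $$ (j, i)"
proof -
  have "H $$ (i, j) = transpose_mat H $$ (i, j)" using H by (simp add: sym_mats_def)
  also have "\<dots> = H $$ (j, i)" using H ij by (subst index_transpose_mat(1)) (auto simp: sym_mats_def)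
  finally show ?thesis .
qed

lemma sum_adjacent_le: "(\<Sum>j<N. if \<bar>int i - int j\<bar> = 1 then 1 else (0::real)) \<le> 2"
proof -
  have "(\<Sum>j<N. if \<bar>int i - int j\<bar> = 1 then 1 else (0::real)) =
      real (card {j \<in> {..<N}. \<bar>int i - int j\<bar> = 1})"
    by (simp add: sum.If_cases Int_def)
  \<comment> \<open>At \<open>i = 0\<close> the truncated \<open>i - 1\<close> is not a neighbour,
    but only the inclusion matters.\<close>
  also have "card {j \<in> {..<N}. \<bar>int i - int j\<bar> = 1} \<le> card {i - 1, i + 1}"
    by (intro card_mono) auto
  also have "\<dots> \<le> 2" by (simp add: card_insert_if)
  finally show ?thesis by simp
qed

text \<open>Diagonal dominance: each off-diagonal term is at least minus
  \<open>\<bar>b\<bar>\<close> times the mean of the two squares, and each index has at most two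
  neighbours, so the form is at least \<open>a - 2 * \<bar>b\<bar>\<close> times the sum of
  squares.\<close>

lemma tridiag_quadratic_form_pos:
  fixes f :: "nat \<Rightarrow> real"
  assumes ab: "a > 0" "a\<^sup>2 > 4 * b\<^sup>2" and f: "\<exists>i<N. f i \<noteq> 0"
  shows "0 < (\<Sum>i<N. \<Sum>j<N. f i * (tridiag a b i j * f j))"
proof -
  let ?e = "\<lambda>i j. if \<bar>int i - int j\<bar> = 1 then 1 else (0::real)"
  let ?S = "\<Sum>i<N. (f i)\<^sup>2"
  have S: "?S > 0" using f by (auto intro!: sum_pos2)
  have "(\<Sum>i<N. \<Sum>j<N. ?e i j * ((f i)\<^sup>2 + (f j)\<^sup>2) / 2) = (\<Sum>i<N. \<Sum>j<N. ?e i j * (f i)\<^sup>2)"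
  proof -
    have "(\<Sum>i<N. \<Sum>j<N. ?e i j * (f j)\<^sup>2) = (\<Sum>i<N. \<Sum>j<N. ?e i j * (f i)\<^sup>2)"
      by (subst sum.swap) (simp add: abs_minus_commute)
    then show ?thesis
      by (simp only: add_divide_distrib distrib_left sum.distrib sum_divide_distrib[symmetric])
  qed
  also have "\<dots> = (\<Sum>i<N. (f i)\<^sup>2 * (\<Sum>j<N. ?e i j))"
    by (simp only: sum_distrib_left mult.commute)
  also have "\<dots> \<le> (\<Sum>i<N. (f i)\<^sup>2 * 2)"
    by (intro sum_mono mult_left_mono sum_adjacent_le) auto
  finally have off: "(\<Sum>i<N. \<Sum>j<N. ?e i j * ((f i)\<^sup>2 + (f j)\<^sup>2) / 2) \<le> 2 * ?S"
    by (simp add: sum_distrib_left mult.commute)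
  have "0 < (a - 2 * \<bar>b\<bar>) * ?S"
    using S two_abs_less[OF ab] by simp
  also have "\<dots> \<le> a * ?S - \<bar>b\<bar> * (\<Sum>i<N. \<Sum>j<N. ?e i j * ((f i)\<^sup>2 + (f j)\<^sup>2) / 2)"
    using mult_left_mono[OF off, of "\<bar>b\<bar>"] by (simp add: algebra_simps)
  also have "\<dots> = (\<Sum>i<N. \<Sum>j<N. (if i = j then a * (f i)\<^sup>2 else 0) -
      \<bar>b\<bar> * (?e i j * ((f i)\<^sup>2 + (f j)\<^sup>2) / 2))"
    by (simp only: sum_subtractf sum_distrib_left) simp
  also have "\<dots> \<le> (\<Sum>i<N. \<Sum>j<N. f i * (tridiag a b i j * f j))"
  proof (intro sum_mono)
    fix i j
    have "2 * \<bar>f i * f j\<bar> \<le> (f i)\<^sup>2 + (f j)\<^sup>2"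
      using sum_squares_bound[of "\<bar>f i\<bar>" "\<bar>f j\<bar>"] by (simp add: abs_mult)
    then have "\<bar>b\<bar> * (2 * \<bar>f i * f j\<bar>) \<le> \<bar>b\<bar> * ((f i)\<^sup>2 + (f j)\<^sup>2)"
      by (intro mult_left_mono) auto
    moreover have "- \<bar>b * (f i * f j)\<bar> \<le> b * (f i * f j)" by linarith
    ultimately have "- (\<bar>b\<bar> * (((f i)\<^sup>2 + (f j)\<^sup>2) / 2)) \<le> b * (f i * f j)"
      by (simp add: abs_mult)
    then show "(if i = j then a * (f i)\<^sup>2 else 0) -
      \<bar>b\<bar> * (?e i j * ((f i)\<^sup>2 + (f j)\<^sup>2) / 2) \<le> f i * (tridiag a b i j * f j)"
      by (simp add: tridiag_def power2_eq_square mult_ac)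
  qed
  finally show ?thesis .
qed

lemma tridiag_mat_spd:
  assumes "a > 0" "a\<^sup>2 > 4 * b\<^sup>2"
  shows "tridiag_mat N a b \<in> spd_mats N"
  unfolding spd_mats_def
proof (intro CollectI conjI ballI impI tridiag_mat_sym)
  fix x :: "real Matrix.vec" assume x: "x \<in> carrier_vec N" "x \<noteq> 0\<^sub>v N"
  have "\<exists>i<N. vec_index x i \<noteq> 0"
  proof (rule ccontr)
    assume "\<not> ?thesis"
    then have "x = 0\<^sub>v N" using x(1) by (intro eq_vecI) auto
    then show False using x(2) by simp
  qed
  then have "0 < (\<Sum>i<N. \<Sum>j<N. vec_index x i * (tridiag a b i j * vec_index x j))"
    by (rule tridiag_quadratic_form_pos[OF assms])
  also have "\<dots> = scalar_prod x (tridiag_mat N a b *\<^sub>v x)"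
    using x(1) by (simp add: scalar_prod_def mult_mat_vec_def sum_distrib_left atLeast0LessThan
        carrier_matD[OF tridiag_mat_carrier] tridiag_mat_index)
  finally show "0 < scalar_prod x (tridiag_mat N a b *\<^sub>v x)" .
qed

section \<open>Lower bound: recovering a direction from its scores\<close>

lemma weighted_variance_eq:
  fixes p s :: "'a \<Rightarrow> real"
  assumes "sum p S = 1"
  defines "m \<equiv> \<Sum>J\<in>S. p J * s J"
  shows "(\<Sum>J\<in>S. p J * (s J * s J)) - m * m = (\<Sum>J\<in>S. p J * (s J - m)\<^sup>2)"
proof -
  have "(\<Sum>J\<in>S. p J * (s J - m)\<^sup>2) =
      (\<Sum>J\<in>S. p J * (s J * s J) - 2 * m * (p J * s J) + m * m * p J)"
    by (intro sum.cong refl) (simp add: power2_eq_square algebra_simps)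
  also have "\<dots> = (\<Sum>J\<in>S. p J * (s J * s J)) - 2 * m * m + m * m * sum p S"
    by (simp only: sum.distrib sum_subtractf sum_distrib_left[symmetric] m_def)
  finally show ?thesis using assms(1) by simp
qed

text \<open>Since every weight is at least \<open>q\<close>, each value lies within
  \<open>sqrt (V / q)\<close> of \<open>m\<close>. The zero value at \<open>I\<close> places
  \<open>m\<close> that close to 0, and the triangle inequality gives the factor 2.\<close>

lemma abs_le_of_weighted_variance:
  fixes p s :: "'a \<Rightarrow> real"
  assumes S: "finite S" and p: "\<And>J. J \<in> S \<Longrightarrow> q \<le> p J" "q > 0"
    and I: "I \<in> S" "s I = 0" and J: "J \<in> S"
    and V: "(\<Sum>J\<in>S. p J * (s J - m)\<^sup>2) \<le> V"
  shows "\<bar>s J\<bar> \<le> 2 * sqrt (V / q)"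
proof -
  have *: "\<bar>s K - m\<bar> \<le> sqrt (V / q)" if K: "K \<in> S" for K
  proof -
    have "q * (s K - m)\<^sup>2 \<le> p K * (s K - m)\<^sup>2" using p K by (intro mult_right_mono) auto
    also have "\<dots> \<le> (\<Sum>J\<in>S. p J * (s J - m)\<^sup>2)"
    proof (rule member_le_sum[OF K _ S])
      fix J assume "J \<in> S - {K}"
      then have "0 \<le> p J" using p(1)[of J] p(2) by simp
      then show "0 \<le> p J * (s J - m)\<^sup>2" by simp
    qed
    finally have "(s K - m)\<^sup>2 \<le> V / q" using V p(2) by (simp add: field_simps)
    then show ?thesis by (intro real_le_rsqrt) simp
  qed
  show ?thesis using *[OF J] *[OF I(1)] I(2) by linarith
qed

lemma dminor_eq_sum_product:
  "finite J \<Longrightarrow> dminor J A H = (\<Sum>(i, j)\<in>J \<times> J. H i j * pcof J A i j)"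
  by (simp add: dminor_eq_sum_pcof sum.cartesian_product)

text \<open>In the cofactor expansion over \<open>{i..j}\<close>, all pairs other than
  \<open>(i, j)\<close> and \<open>(j, i)\<close> are closer to the diagonal and hence bounded by
  \<open>u\<close>. The two corner terms are equal by symmetry, so they cannot cancel, and their
  cofactor has absolute value \<open>\<bar>b\<bar> ^ (j - i)\<close>.\<close>

lemma entry_bound_step:
  assumes ij: "i \<le> j" and b: "b \<noteq> 0 \<or> i = j"
    and H: "\<And>k l. k \<in> {i..j} \<Longrightarrow> l \<in> {i..j} \<Longrightarrow> H k l = H l k"
    and IH: "\<And>k l. i \<le> k \<Longrightarrow> k \<le> l \<Longrightarrow> l \<le> j \<Longrightarrow> l - k < j - i \<Longrightarrow> \<bar>H k l\<bar> \<le> u"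
    and t: "\<bar>dminor {i..j} (tridiag a b) H\<bar> \<le> t" and u: "u \<ge> 0"
  shows "\<bar>H i j\<bar> \<le> (t + u * (\<Sum>(k, l)\<in>{i..j} \<times> {i..j}. \<bar>pcof {i..j} (tridiag a b) k l\<bar>)) / \<bar>b\<bar> ^ (j - i)"
proof -
  let ?J = "{i..j}" and ?c = "pcof {i..j} (tridiag a b)"
  let ?R = "?J \<times> ?J - {(i, j), (j, i)}"
  have sym: "?c j i = ?c i j" by (rule pcof_sym) (simp_all add: tridiag_sym)
  have "dminor ?J (tridiag a b) H = (\<Sum>(k, l)\<in>{(i, j), (j, i)}. H k l * ?c k l) + (\<Sum>(k, l)\<in>?R. H k l * ?c k l)"
    unfolding dminor_eq_sum_product[OF finite_atLeastAtMost]
    using ij by (subst sum.subset_diff[of "{(i, j), (j, i)}"]) auto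
  moreover have "\<bar>H i j\<bar> * \<bar>b\<bar> ^ (j - i) \<le> \<bar>\<Sum>(k, l)\<in>{(i, j), (j, i)}. H k l * ?c k l\<bar>"
  proof -
    \<comment> \<open>For \<open>i = j\<close> the two corners are a single pair; either way the
      factor is at least 1.\<close>
    have "(\<Sum>(k, l)\<in>{(i, j), (j, i)}. H k l * ?c k l) = (if i = j then 1 else 2) * (H i j * ?c i j)"
      using sym H[of j i] ij by auto
    then show ?thesis
      using abs_pcof_tridiag_interval[OF ij, of a b] by (simp add: abs_mult)
  qed
  moreover have "\<bar>\<Sum>(k, l)\<in>?R. H k l * ?c k l\<bar> \<le> u * (\<Sum>(k, l)\<in>?J \<times> ?J. \<bar>?c k l\<bar>)"
  proof -
    have "\<bar>\<Sum>(k, l)\<in>?R. H k l * ?c k l\<bar> \<le> (\<Sum>(k, l)\<in>?R. u * \<bar>?c k l\<bar>)"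
    proof (intro order.trans[OF sum_abs] sum_mono)
      fix kl assume R: "kl \<in> ?R"
      obtain k l where kl: "kl = (k, l)" by (cases kl)
      have J: "k \<in> ?J" "l \<in> ?J" and ne: "\<not> (k = i \<and> l = j)" "\<not> (k = j \<and> l = i)"
        using R unfolding kl by blast+
      have "\<bar>H k l\<bar> \<le> u"
      proof (cases "k \<le> l")
        case True
        then show ?thesis using J ne by (intro IH) auto
      next
        case False
        then have "\<bar>H l k\<bar> \<le> u" using J ne by (intro IH) auto
        then show ?thesis using H[OF J] by simp
      qed
      then show "\<bar>case kl of (k, l) \<Rightarrow> H k l * ?c k l\<bar> \<le> (case kl of (k, l) \<Rightarrow> u * \<bar>?c k l\<bar>)"
        by (simp add: kl abs_mult mult_right_mono)
    qed
    also have "\<dots> \<le> (\<Sum>(k, l)\<in>?J \<times> ?J. u * \<bar>?c k l\<bar>)"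
      using u by (intro sum_mono2) auto
    finally show ?thesis by (simp add: sum_distrib_left case_prod_beta)
  qed
  ultimately have "\<bar>H i j\<bar> * \<bar>b\<bar> ^ (j - i) \<le> t + u * (\<Sum>(k, l)\<in>?J \<times> ?J. \<bar>?c k l\<bar>)"
    using t by linarith
  moreover have "\<bar>b\<bar> ^ (j - i) > 0" using b by auto
  ultimately show ?thesis by (simp add: pos_le_divide_eq)
qed

text \<open>One constant \<open>C\<close> serves all \<open>H\<close> and \<open>t\<close>, which
  later makes the lower bound uniform over the unit sphere. The width \<open>d\<close> is the
  induction variable.\<close>

definition score_controls_band :: "real \<Rightarrow> real \<Rightarrow> nat \<Rightarrow> nat \<Rightarrow> real \<Rightarrow> bool" where
  "score_controls_band a b N d C \<longleftrightarrow> (\<forall>H\<in>sym_mats N. \<forall>t\<ge>0.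
    (\<forall>J\<subseteq>{..<N}. \<bar>score J (tridiag a b) (\<lambda>i j. H $$ (i, j))\<bar> \<le> t) \<longrightarrow>
    (\<forall>i j. i \<le> j \<longrightarrow> j < N \<longrightarrow> j - i < d \<longrightarrow> \<bar>H $$ (i, j)\<bar> \<le> C * t))"

lemma ex_score_controls_band:
  assumes ab: "a > 0" "a\<^sup>2 > 4 * b\<^sup>2" and b: "b \<noteq> 0 \<or> N = 1"
  shows "\<exists>C\<ge>0. score_controls_band a b N d C"
proof (induction d)
  case 0
  show ?case by (auto simp: score_controls_band_def)
next
  case (Suc d)
  then obtain C where C: "C \<ge> 0" "score_controls_band a b N d C" by blast
  note band = C(2)[unfolded score_controls_band_def, rule_format]
  \<comment> \<open>The constant of \<open>entry_bound_step\<close> with \<open>t\<close> factored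
    out: a score bound \<open>t\<close> bounds \<open>dminor\<close> by the minor times
    \<open>t\<close>, and the inner entries are at most \<open>C * t\<close>.\<close>
  define c where "c i j = (pminor {i..j} (tridiag a b) +
      C * (\<Sum>(k, l)\<in>{i..j} \<times> {i..j}. \<bar>pcof {i..j} (tridiag a b) k l\<bar>)) / \<bar>b\<bar> ^ (j - i)" for i j
  have c: "c i j \<ge> 0" for i j
    unfolding c_def using C(1) pminor_tridiag_pos[OF ab, of "{i..j}"]
    by (intro divide_nonneg_nonneg add_nonneg_nonneg mult_nonneg_nonneg sum_nonneg) auto
  define C' where "C' = C + (\<Sum>i<N. \<Sum>j<N. c i j)"
  have CC': "C \<le> C'" unfolding C'_def using c by (simp add: sum_nonneg)
  have cC': "c i j \<le> C'" if "i < N" "j < N" for i j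
  proof -
    have "c i j \<le> (\<Sum>j<N. c i j)" using c that by (intro member_le_sum) auto
    also have "\<dots> \<le> (\<Sum>i<N. \<Sum>j<N. c i j)"
      using c that by (intro member_le_sum[where f = "\<lambda>i. \<Sum>j<N. c i j"]) (auto intro: sum_nonneg)
    finally show ?thesis using C(1) by (simp add: C'_def)
  qed
  have "\<bar>H $$ (i, j)\<bar> \<le> C' * t"
    if H: "H \<in> sym_mats N" and t: "t \<ge> 0"
      and s: "\<And>J. J \<subseteq> {..<N} \<Longrightarrow> \<bar>score J (tridiag a b) (\<lambda>i j. H $$ (i, j))\<bar> \<le> t"
      and ij: "i \<le> j" "j < N" "j - i < Suc d" for H t i j
  proof (cases "j - i < d")
    case True
    then have "\<bar>H $$ (i, j)\<bar> \<le> C * t" using ij by (intro band[OF H t s])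
    also have "\<dots> \<le> C' * t" using CC' t by (rule mult_right_mono)
    finally show ?thesis .
  next
    case False
    have J: "{i..j} \<subseteq> {..<N}" using ij by auto
    have pos: "pminor {i..j} (tridiag a b) > 0" using pminor_tridiag_pos[OF ab] by simp
    have "\<bar>H $$ (i, j)\<bar> \<le> (pminor {i..j} (tridiag a b) * t +
        C * t * (\<Sum>(k, l)\<in>{i..j} \<times> {i..j}. \<bar>pcof {i..j} (tridiag a b) k l\<bar>)) / \<bar>b\<bar> ^ (j - i)"
    proof (rule entry_bound_step[where H = "\<lambda>i j. H $$ (i, j)", OF ij(1)])
      show "b \<noteq> 0 \<or> i = j" using b ij by auto
      show "H $$ (k, l) = H $$ (l, k)" if "k \<in> {i..j}" "l \<in> {i..j}" for k l
        using that ij by (intro sym_mats_index[OF H]) auto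
      show "\<bar>H $$ (k, l)\<bar> \<le> C * t" if "i \<le> k" "k \<le> l" "l \<le> j" "l - k < j - i" for k l
        using that ij False by (intro band[OF H t s]) auto
      show "\<bar>dminor {i..j} (tridiag a b) (\<lambda>i j. H $$ (i, j))\<bar> \<le> pminor {i..j} (tridiag a b) * t"
        using s[OF J] pos by (simp add: score_def abs_divide pos_divide_le_eq mult.commute)
      show "C * t \<ge> 0" using C t by simp
    qed
    also have "\<dots> = c i j * t" by (simp add: c_def algebra_simps add_divide_distrib)
    also have "\<dots> \<le> C' * t" using cC'[of i j] ij t by (intro mult_right_mono) auto
    finally show ?thesis .
  qed
  then have "score_controls_band a b N (Suc d) C'" by (simp add: score_controls_band_def)
  moreover have "C' \<ge> 0" using CC' C(1) by linarith
  ultimately show ?case by blast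
qed

text \<open>Adding the identity only raises the diagonal to \<open>a + 1\<close>, so the normalising
  constant is again a tridiagonal minor and the same estimates apply to it.\<close>

lemma sum_pminor_tridiag: "(\<Sum>J\<in>Pow {..<N}. pminor J (tridiag a b)) = pminor {..<N} (tridiag (a + 1) b)"
proof -
  have "(\<lambda>i j. (if i = j then 1 else 0) + tridiag a b i j) = tridiag (a + 1) b"
    by (auto simp: tridiag_def fun_eq_iff)
  then show ?thesis using pminor_identity_add[of "{..<N}" "tridiag a b"] by simp
qed

lemma pminor_tridiag_mat:
  "J \<subseteq> {..<N} \<Longrightarrow> pminor J (\<lambda>i j. tridiag_mat N a b $$ (i, j)) = pminor J (tridiag a b)"
  by (intro pminor_cong tridiag_mat_index) auto

lemma dpp_pmf_tridiag:
  assumes "J \<subseteq> {..<N}"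
  shows "dpp_pmf N (tridiag_mat N a b) J =
    pminor J (tridiag a b) / pminor {..<N} (tridiag (a + 1) b)"
  using assms
  by (simp add: dpp_pmf_eq[OF tridiag_mat_carrier] pminor_tridiag_mat flip: sum_pminor_tridiag)

lemma shifted_condition:
  assumes "a > 0" "a\<^sup>2 > 4 * (b::real)\<^sup>2"
  shows "a + 1 > 0" "(a + 1)\<^sup>2 > 4 * b\<^sup>2"
  using assms by (auto simp: power2_eq_square algebra_simps)

lemma sum_dpp_pmf_tridiag:
  assumes "a > 0" "a\<^sup>2 > 4 * b\<^sup>2"
  shows "(\<Sum>J\<in>Pow {..<N}. dpp_pmf N (tridiag_mat N a b) J) = 1"
proof -
  have "pminor {..<N} (tridiag (a + 1) b) > 0"
    by (intro pminor_tridiag_pos shifted_condition[OF assms]) simp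
  moreover have "(\<Sum>J\<in>Pow {..<N}. dpp_pmf N (tridiag_mat N a b) J) =
      (\<Sum>J\<in>Pow {..<N}. pminor J (tridiag a b)) / pminor {..<N} (tridiag (a + 1) b)"
    unfolding sum_divide_distrib by (intro sum.cong refl dpp_pmf_tridiag) auto
  ultimately show ?thesis by (simp add: sum_pminor_tridiag)
qed

lemma dpp_pmf_tridiag_pos:
  assumes "a > 0" "a\<^sup>2 > 4 * b\<^sup>2" "J \<subseteq> {..<N}"
  shows "dpp_pmf N (tridiag_mat N a b) J > 0"
  using assms pminor_tridiag_pos[OF assms(1,2), of J] finite_subset[OF assms(3)]
    pminor_tridiag_pos[OF shifted_condition[OF assms(1,2)], of "{..<N}"]
  by (simp add: dpp_pmf_tridiag)

lemma score_tridiag_mat: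
  "J \<subseteq> {..<N} \<Longrightarrow> score J (\<lambda>i j. tridiag_mat N a b $$ (i, j)) H = score J (tridiag a b) H"
  by (intro score_cong tridiag_mat_index) auto

text \<open>The moment form serves the upper bound, where the squared mean is dropped; the sum of
  squares serves nonnegativity and the lower bound.\<close>

lemma score_cov_tridiag:
  assumes "a > 0" "a\<^sup>2 > 4 * b\<^sup>2"
  fixes H :: "real mat" and N :: nat
  defines "p \<equiv> dpp_pmf N (tridiag_mat N a b)"
    and "s \<equiv> \<lambda>J. score J (tridiag a b) (\<lambda>i j. H $$ (i, j))"
  shows "score_cov N (tridiag_mat N a b) H H =
      (\<Sum>J\<in>Pow {..<N}. p J * (s J * s J)) - (\<Sum>J\<in>Pow {..<N}. p J * s J) * (\<Sum>J\<in>Pow {..<N}. p J * s J)"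
    and "score_cov N (tridiag_mat N a b) H H =
      (\<Sum>J\<in>Pow {..<N}. p J * (s J - (\<Sum>J\<in>Pow {..<N}. p J * s J))\<^sup>2)"
proof -
  show *: "score_cov N (tridiag_mat N a b) H H =
      (\<Sum>J\<in>Pow {..<N}. p J * (s J * s J)) - (\<Sum>J\<in>Pow {..<N}. p J * s J) * (\<Sum>J\<in>Pow {..<N}. p J * s J)"
    by (simp add: score_cov_def p_def s_def score_tridiag_mat)
  show "score_cov N (tridiag_mat N a b) H H =
      (\<Sum>J\<in>Pow {..<N}. p J * (s J - (\<Sum>J\<in>Pow {..<N}. p J * s J))\<^sup>2)"
    unfolding * by (rule weighted_variance_eq) (simp add: p_def sum_dpp_pmf_tridiag assms)
qed

lemma score_cov_tridiag_nonneg: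
  assumes "a > 0" "a\<^sup>2 > 4 * b\<^sup>2"
  shows "score_cov N (tridiag_mat N a b) H H \<ge> 0"
  unfolding score_cov_tridiag(2)[OF assms]
  using dpp_pmf_tridiag_pos[OF assms] by (intro sum_nonneg mult_nonneg_nonneg) (auto simp: less_imp_le)

text \<open>A small variance forces small scores, since the score at the empty set is 0; small
  scores force small entries; and a unit Frobenius norm excludes entries that are all small.\<close>

lemma score_cov_tridiag_bounded_below:
  assumes ab: "a > 0" "a\<^sup>2 > 4 * b\<^sup>2" and b: "b \<noteq> 0 \<or> N = 1"
  shows "\<exists>c>0. \<forall>H\<in>sym_mats N. frobenius_norm H = 1 \<longrightarrow> c \<le> score_cov N (tridiag_mat N a b) H H"
proof -
  let ?p = "dpp_pmf N (tridiag_mat N a b)" and ?S = "Pow {..<N}"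
  obtain C where C: "C \<ge> 0" "score_controls_band a b N N C"
    using ex_score_controls_band[OF ab b] by blast
  note band = C(2)[unfolded score_controls_band_def, rule_format]
  define q where "q = Min (?p ` ?S)"
  have "\<And>J. J \<in> ?S \<Longrightarrow> q \<le> ?p J" by (simp add: q_def)
  moreover have "q > 0"
    using dpp_pmf_tridiag_pos[OF ab, of _ N] unfolding q_def by (subst Min_gr_iff) auto
  ultimately have q: "q > 0" "\<And>J. J \<in> ?S \<Longrightarrow> q \<le> ?p J" by simp_all
  \<comment> \<open>Each of the \<open>N * N\<close> squared entries is at most
    \<open>(C * t)\<close> squared, where the square of \<open>t\<close> is
    \<open>4 * (V / q)\<close>; so a unit norm gives \<open>1 \<le> D * (V / q)\<close>.\<close>
  define D where "D = real N * real N * (4 * C\<^sup>2)"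
  have D: "D \<ge> 0" by (simp add: D_def)
  have "q / (D + 1) \<le> score_cov N (tridiag_mat N a b) H H"
    if H: "H \<in> sym_mats N" "frobenius_norm H = 1" for H
  proof -
    define V where "V = score_cov N (tridiag_mat N a b) H H"
    define t where "t = 2 * sqrt (V / q)"
    have V: "V \<ge> 0" unfolding V_def by (rule score_cov_tridiag_nonneg[OF ab])
    have t: "t \<ge> 0" "t\<^sup>2 = 4 * (V / q)" using V q by (auto simp: t_def power_mult_distrib)
    have s: "\<bar>score J (tridiag a b) (\<lambda>i j. H $$ (i, j))\<bar> \<le> t" if "J \<subseteq> {..<N}" for J
      unfolding t_def
    proof (rule abs_le_of_weighted_variance[where S = ?S and I = "{}" and p = ?p
          and s = "\<lambda>J. score J (tridiag a b) (\<lambda>i j. H $$ (i, j))"])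
      show "score {} (tridiag a b) (\<lambda>i j. H $$ (i, j)) = 0" by (simp add: score_def dminor_def)
      show "(\<Sum>J\<in>?S. ?p J * (score J (tridiag a b) (\<lambda>i j. H $$ (i, j)) -
          (\<Sum>J\<in>?S. ?p J * score J (tridiag a b) (\<lambda>i j. H $$ (i, j))))\<^sup>2) \<le> V"
        unfolding V_def score_cov_tridiag(2)[OF ab] by (rule order.refl)
    qed (use that q in auto)
    have dims: "dim_row H = N" "dim_col H = N" using H by (auto simp: sym_mats_def)
    have entry: "\<bar>H $$ (i, j)\<bar> \<le> C * t" if "i < N" "j < N" for i j
    proof (cases "i \<le> j")
      case True
      then show ?thesis using that by (intro band[OF H(1) t(1) s]) auto
    next
      case False
      have "H $$ (i, j) = H $$ (j, i)"
        using that by (intro sym_mats_index[OF H(1)]) auto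
      moreover have "\<bar>H $$ (j, i)\<bar> \<le> C * t" using that False by (intro band[OF H(1) t(1) s]) auto
      ultimately show ?thesis by simp
    qed
    have "1 = (frobenius_norm H)\<^sup>2" using H by simp
    also have "\<dots> = (\<Sum>i<N. \<Sum>j<N. (H $$ (i, j))\<^sup>2)"
      by (simp add: frobenius_norm_def dims sum_nonneg)
    also have "\<dots> \<le> (\<Sum>i<N. \<Sum>j<N. (C * t)\<^sup>2)"
    proof (intro sum_mono)
      fix i j assume "i \<in> {..<N}" "j \<in> {..<N}"
      then show "(H $$ (i, j))\<^sup>2 \<le> (C * t)\<^sup>2"
        using entry[of i j] power_mono[of "\<bar>H $$ (i, j)\<bar>" "C * t" 2] by simp
    qed
    also have "\<dots> = D * (V / q)" by (simp add: D_def power_mult_distrib t(2))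
    finally have "q \<le> D * V" using q by (simp add: field_simps)
    also have "\<dots> \<le> (D + 1) * V" using V by (simp add: algebra_simps)
    finally show ?thesis using D by (simp add: V_def pos_divide_le_eq mult.commute)
  qed
  moreover have "q / (D + 1) > 0" using q D by simp
  ultimately show ?thesis by blast
qed

section \<open>Upper bound: the corner direction\<close>

definition corners :: "nat \<Rightarrow> (nat \<times> nat) set" where
  "corners N = {(0, N - 1), (N - 1, 0)}"

lemma card_corners: "card (corners N) \<in> {1, 2}"
  by (auto simp: corners_def card_insert_if)

text \<open>For \<open>N = 1\<close> the two corners coincide; dividing by the square root of the
  actual number of corners gives a unit norm in both cases.\<close>

definition corner_mat :: "nat \<Rightarrow> real mat" where
  "corner_mat N =
     Matrix.mat N N (\<lambda>ij. if ij \<in> corners N then 1 / sqrt (card (corners N)) else 0)"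

lemma corner_mat_unit:
  assumes N: "N \<ge> 1"
  shows "corner_mat N \<in> sym_mats N" "frobenius_norm (corner_mat N) = 1"
proof -
  show "corner_mat N \<in> sym_mats N"
    by (auto simp: sym_mats_def corner_mat_def corners_def intro!: eq_matI)
  have sub: "corners N \<subseteq> {..<N} \<times> {..<N}" using N by (auto simp: corners_def)
  have "(\<Sum>i<N. \<Sum>j<N. (corner_mat N $$ (i, j))\<^sup>2) = (\<Sum>ij\<in>{..<N} \<times> {..<N}. (corner_mat N $$ ij)\<^sup>2)"
    by (simp add: sum.cartesian_product)
  also have "\<dots> = (\<Sum>ij\<in>corners N. (1 / sqrt (card (corners N)))\<^sup>2)"
    using sub by (intro sum.mono_neutral_cong_right) (auto simp: corner_mat_def)
  also have "\<dots> = 1" using card_corners[of N] by (auto simp: power_divide)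
  finally show "frobenius_norm (corner_mat N) = 1"
    by (simp add: frobenius_norm_def corner_mat_def)
qed

text \<open>A proper subset \<open>J\<close> either misses a corner index, so that no term remains,
  or contains both and has a gap, so that the corner cofactor vanishes. For the full set the square
  is the number of corners, at most 2, times the squared corner cofactor.\<close>

lemma dminor_corner_mat:
  assumes N: "N \<ge> 1" and J: "J \<subseteq> {..<N}"
  shows "(dminor J (tridiag a b) (\<lambda>i j. corner_mat N $$ (i, j)))\<^sup>2 \<le>
    (if J = {..<N} then 2 * (b\<^sup>2) ^ (N - 1) else 0)"
proof -
  let ?K = "corners N" and ?c = "pcof J (tridiag a b)"
  have fin: "finite J" using J finite_subset by auto
  have card: "card ?K \<in> {1, 2}" by (rule card_corners)
  have idx: "corner_mat N $$ (k, l) = (if (k, l) \<in> ?K then 1 / sqrt (card ?K) else 0)"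
    if "k \<in> J" "l \<in> J" for k l
    unfolding corner_mat_def using subsetD[OF J] that by (subst index_mat(1)) auto
  have eq: "dminor J (tridiag a b) (\<lambda>i j. corner_mat N $$ (i, j)) =
      (\<Sum>(k, l)\<in>?K \<inter> J \<times> J. 1 / sqrt (card ?K) * ?c k l)"
    unfolding dminor_eq_sum_product[OF fin]
  proof (rule sum.mono_neutral_cong_right)
    show "\<forall>kl\<in>J \<times> J - ?K \<inter> J \<times> J. (case kl of (k, l) \<Rightarrow> corner_mat N $$ (k, l) * ?c k l) = 0"
      by (auto simp: idx split: if_splits)
    show "(case kl of (k, l) \<Rightarrow> corner_mat N $$ (k, l) * ?c k l) =
        (case kl of (k, l) \<Rightarrow> 1 / sqrt (card ?K) * ?c k l)" if "kl \<in> ?K \<inter> J \<times> J" for kl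
      using that by (cases kl) (auto simp: idx)
  qed (use fin in auto)
  have sym: "?c (N - 1) 0 = ?c 0 (N - 1)" by (rule pcof_sym) (simp_all add: tridiag_sym fin)
  show ?thesis
  proof (cases "J = {..<N}")
    case True
    then have J': "J = {0..N - 1}" using N by auto
    have c: "\<bar>?c 0 (N - 1)\<bar> = \<bar>b\<bar> ^ (N - 1)"
      using abs_pcof_tridiag_interval[of 0 "N - 1"] by (simp add: J')
    have "?K \<inter> J \<times> J = ?K" using N True by (auto simp: corners_def)
    then have "dminor J (tridiag a b) (\<lambda>i j. corner_mat N $$ (i, j)) =
        (\<Sum>(k, l)\<in>?K. 1 / sqrt (card ?K) * ?c k l)"
      by (simp only: eq)
    also have "\<dots> = (\<Sum>kl\<in>?K. 1 / sqrt (card ?K) * ?c 0 (N - 1))"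
    proof (rule sum.cong[OF refl])
      fix kl assume "kl \<in> ?K"
      then consider "kl = (0, N - 1)" | "kl = (N - 1, 0)" unfolding corners_def by blast
      then show "(case kl of (k, l) \<Rightarrow> 1 / sqrt (card ?K) * ?c k l) = 1 / sqrt (card ?K) * ?c 0 (N - 1)"
        by cases (simp_all only: prod.case sym)
    qed
    also have "\<dots> = real (card ?K) / sqrt (card ?K) * ?c 0 (N - 1)"
      by simp
    finally have "(dminor J (tridiag a b) (\<lambda>i j. corner_mat N $$ (i, j)))\<^sup>2 =
        real (card ?K) * \<bar>?c 0 (N - 1)\<bar>\<^sup>2"
      by (simp only: power_mult_distrib real_div_sqrt real_sqrt_pow2 of_nat_0_le_iff power2_abs)
    also have "\<dots> = real (card ?K) * (b\<^sup>2) ^ (N - 1)"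
    proof -
      have "(\<bar>b\<bar> ^ (N - 1))\<^sup>2 = (\<bar>b\<bar>\<^sup>2) ^ (N - 1)"
        by (simp only: power_mult[symmetric] mult.commute)
      then show ?thesis by (simp only: c power2_abs)
    qed
    also have "\<dots> \<le> 2 * (b\<^sup>2) ^ (N - 1)"
      using card by (intro mult_right_mono) auto
    finally show ?thesis using True by simp
  next
    case False
    have "?c k l = 0" if "(k, l) \<in> ?K \<inter> J \<times> J" for k l
    proof -
      have "J \<subset> {0..N - 1}" using False J N by auto
      then have "?c 0 (N - 1) = 0" using that by (intro pcof_tridiag_gap) (auto simp: corners_def)
      then show ?thesis using that sym by (auto simp: corners_def)
    qed
    then have "dminor J (tridiag a b) (\<lambda>i j. corner_mat N $$ (i, j)) = 0"
      unfolding eq by (intro sum.neutral) auto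
    then show ?thesis using False by simp
  qed
qed

lemma score_cov_corner_mat_le:
  assumes ab: "a > 0" "a\<^sup>2 > 4 * b\<^sup>2" and N: "N \<ge> 1"
  shows "score_cov N (tridiag_mat N a b) (corner_mat N) (corner_mat N) \<le> 8 / a\<^sup>2 * (a / (a + 1)) ^ N"
proof -
  let ?p = "dpp_pmf N (tridiag_mat N a b)" and ?A = "tridiag a b"
  let ?s = "\<lambda>J. score J ?A (\<lambda>i j. corner_mat N $$ (i, j))"
  let ?m = "pminor {..<N} ?A" and ?Z = "pminor {..<N} (tridiag (a + 1) b)"
  have s0: "?s J = 0" if "J \<in> Pow {..<N} - {{..<N}}" for J
    using dminor_corner_mat[OF N, of J a b] that by (simp add: score_def)
  have m: "?m \<ge> (a / 2) ^ N" "(a / 2) ^ N > 0"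
    using pminor_tridiag_ge_power[OF ab] ab by auto
  have Z: "?Z \<ge> ((a + 1) / 2) ^ N" "((a + 1) / 2) ^ N > 0"
    using pminor_tridiag_ge_power[OF shifted_condition[OF ab]] ab by auto
  have "score_cov N (tridiag_mat N a b) (corner_mat N) (corner_mat N) \<le>
      (\<Sum>J\<in>Pow {..<N}. ?p J * (?s J * ?s J))"
    unfolding score_cov_tridiag(1)[OF ab] by simp
  also have "\<dots> = ?p {..<N} * (?s {..<N} * ?s {..<N})"
    using s0 by (subst sum.remove[of _ "{..<N}"]) (auto intro!: sum.neutral)
  \<comment> \<open>The probability \<open>?m / ?Z\<close> cancels one of the two factors
    \<open>?m\<close> in the denominator of the squared score.\<close>
  also have "\<dots> = (dminor {..<N} ?A (\<lambda>i j. corner_mat N $$ (i, j)))\<^sup>2 / (?m * ?Z)"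
    using m Z by (simp add: dpp_pmf_tridiag score_def power2_eq_square)
  also have "\<dots> \<le> 2 * (b\<^sup>2) ^ (N - 1) / ((a / 2) ^ N * ((a + 1) / 2) ^ N)"
    using dminor_corner_mat[OF N order.refl, of a b] m Z
    by (intro frac_le mult_mono) auto
  also have "\<dots> \<le> 2 * ((a / 2)\<^sup>2) ^ (N - 1) / ((a / 2) ^ N * ((a + 1) / 2) ^ N)"
  proof -
    have "(b\<^sup>2) ^ (N - 1) \<le> ((a / 2)\<^sup>2) ^ (N - 1)"
      using ab by (intro power_mono[of "b\<^sup>2"]) (auto simp: power_divide)
    then show ?thesis using ab by (intro divide_right_mono mult_left_mono) auto
  qed
  also have "\<dots> = 8 / a\<^sup>2 * (a / (a + 1)) ^ N"
  proof -
    obtain n where n: "N = Suc n" using N by (cases N) auto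
    \<comment> \<open>Used with \<open>x = a / 2\<close> and \<open>y = (a + 1) / 2\<close>: the
      numerator carries two powers of \<open>x\<close> fewer than needed, which produces the
      constant \<open>8 / a\<^sup>2\<close>.\<close>
    have ratio: "2 * (x\<^sup>2) ^ n / (x ^ Suc n * y ^ Suc n) = 2 / x\<^sup>2 * (x / y) ^ Suc n"
      if "x > 0" "y > 0" for x y :: real
      using that by (simp add: power_divide power_mult_distrib power2_eq_square)
    have "2 / (a / 2)\<^sup>2 = 8 / a\<^sup>2" "a / 2 / ((a + 1) / 2) = a / (a + 1)"
      using ab by (simp_all add: power_divide)
    then show ?thesis using ratio[of "a / 2" "(a + 1) / 2"] ab by (simp only: n) simp
  qed
  finally show ?thesis .
qed

text \<open>Positivity of the infimum is claimed for \<open>b \<noteq> 0\<close> or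
  \<open>N = 1\<close>. If \<open>b = 0\<close> and \<open>N \<ge> 2\<close>, all off-diagonal
  cofactors vanish, so a direction with zero diagonal has score 0 at every \<open>J\<close> and the
  infimum is 0.\<close>

theorem proposition4:
  fixes a b :: real
  assumes "a > 0" and "a\<^sup>2 > 4 * b\<^sup>2"
  shows "(\<forall>N\<ge>1. tridiag_mat N a b \<in> spd_mats N) \<and>
    (\<exists>c1>0. \<exists>c2>0. \<forall>N\<ge>1. \<exists>B.
       has_second_derivative_sym N (expected_log_likelihood N (tridiag_mat N a b))
         (tridiag_mat N a b) B \<and>
       (b \<noteq> 0 \<or> N = 1 \<longrightarrow>
          0 < (INF H \<in> {H \<in> sym_mats N. frobenius_norm H = 1}. - B H H)) \<and>
       (INF H \<in> {H \<in> sym_mats N. frobenius_norm H = 1}. - B H H) \<le> c1 * exp (- c2 * real N))"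
proof (intro conjI allI impI exI)
  show "tridiag_mat N a b \<in> spd_mats N" for N
    by (rule tridiag_mat_spd[OF assms])
  \<comment> \<open>The witnesses for \<open>c1\<close> and \<open>c2\<close>; the second is chosen
    so that \<open>exp (- c2)\<close> equals the ratio \<open>a / (a + 1)\<close> of the corner
    estimate.\<close>
  show "8 / a\<^sup>2 > 0" "ln ((a + 1) / a) > 0"
    using assms(1) by simp_all
  fix N :: nat assume N: "N \<ge> 1"
  let ?L = "tridiag_mat N a b" and ?U = "{H \<in> sym_mats N. frobenius_norm H = 1}"
  let ?V = "score_cov N (tridiag_mat N a b)"
  show "has_second_derivative_sym N (expected_log_likelihood N ?L) ?L (\<lambda>K H. - ?V K H)"
    using pminor_tridiag_pos[OF assms] finite_subset
    by (intro has_second_derivative_expected_log_likelihood tridiag_mat_sym)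
      (auto simp: pminor_tridiag_mat)
  \<comment> \<open>On the reals, \<open>INF\<close> is the true infimum only for a nonempty set
    bounded below; \<open>bdd\<close> and \<open>corner\<close> supply these two facts.\<close>
  have bdd: "bdd_below ((\<lambda>H. - (- ?V H H)) ` ?U)"
    using score_cov_tridiag_nonneg[OF assms] by (intro bdd_belowI[of _ 0]) auto
  have corner: "corner_mat N \<in> ?U" using corner_mat_unit[OF N] by simp
  show "0 < (INF H \<in> ?U. - (- ?V H H))" if b: "b \<noteq> 0 \<or> N = 1"
  proof -
    obtain c where "c > 0" "\<And>H. H \<in> ?U \<Longrightarrow> c \<le> - (- ?V H H)"
      using score_cov_tridiag_bounded_below[OF assms b] by auto
    moreover from this(2) have "c \<le> (INF H \<in> ?U. - (- ?V H H))"
      using corner by (intro cINF_greatest) auto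
    ultimately show ?thesis by linarith
  qed
  have "(INF H \<in> ?U. - (- ?V H H)) \<le> - (- ?V (corner_mat N) (corner_mat N))"
    using bdd corner by (rule cINF_lower)
  also have "\<dots> \<le> 8 / a\<^sup>2 * (a / (a + 1)) ^ N"
    using score_cov_corner_mat_le[OF assms N] by simp
  also have "(a / (a + 1)) ^ N = exp (- ln ((a + 1) / a)) ^ N"
    using assms(1) by (simp add: exp_minus)
  also have "\<dots> = exp (- ln ((a + 1) / a) * real N)"
    by (simp add: exp_of_nat_mult[symmetric] mult.commute)
  finally show "(INF H \<in> ?U. - (- ?V H H)) \<le> 8 / a\<^sup>2 * exp (- ln ((a + 1) / a) * real N)" .
qed

end
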